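(* Let $P$ and $Q$ be connected pointed multi-symmetric collections of finite-dimensional vector spaces. Then the Young generating series of their contraction product $P\circ Q$ is the composition, with respect to the variable $z$, of the Young generating series of $P$ and $Q$: $$F_{\mathsf{Y}}(P\circ Q)(z;x_1,x_2,\ldots)=F_{\mathsf{Y}}(P)\bigl(F_{\mathsf{Y}}(Q)(z;x_1,x_2,\ldots);x_1,x_2,\ldots\bigr).$$
   Context: A pointed partition of a finite set $T$ is a partition $J_*=\underline{J_0}\sqcup J_1\sqcup\dots\sqcup J_l$ of $T$ in which one part $J_0$ is marked; the marked part may be empty, the other parts are non-empty and unordered. Pointed partitions of finite sets form a groupoid, with morphisms the bijections preserving the partitions and the marked parts. A pointed multi-symmetric collection $P$ is a contravariant functor from this groupoid to (finite-dimensional) vector spaces. Up to isomorphism a pointed partition is determined by the cardinality $m\ge0$ of the marked part and the integer partition $\lambda$ of the cardinalities of the other parts; one writes $P(m;\lambda)$ for the value. For a subset $S\subset T$ the induced pointed partition is $J_*\cap S=\underline{J_0\cap S}\sqcup(J_1\cap S)\sqcup\dots\sqcup(J_l\cap S)$ (empty unmarked parts are dropped). For an ordinary set partition $I_\bullet=\{I_1,\dots,I_k\}$ of $T$, the contracted pointed partition $J_*/I_\bullet$ is the pointed partition of the $k$-element set of blocks with unmarked parts $\{s:\ |I_s|=1,\ I_s\subset J_j\}$ for $j\ge1$ (empty ones dropped) and marked part $\{s:\ |I_s|=1,\ I_s\subset J_0\}\cup\{s:\ |I_s|>1\}$. The contraction product is $$(P\circ Q)(J_* )=\bigoplus_{I_\bullet}P(J_*/I_\bullet)\otimes\bigotimes_{I_s\in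 I_\bullet}Q(J_*\cap I_s),$$ the sum being over all set partitions $I_\bullet$ of the underlying set. Connected means that the value on a one-element set is the unit (one-dimensional): $P(1;\emptyset)$ is the identity, and for a one-element block lying in an unmarked part the corresponding tensor factor in the product above is the unit (it is the identity operation of that unmarked part and is not counted in the generating series). For a connected collection the Young generating series therefore has linear term $z$ and reads $$F_{\mathsf{Y}}(P)(z;x_1,x_2,\dots)=z+\sum_{n\ge0,\ \lambda:\ n+|\lambda|\ge2}\dim P(n;\lambda)\,\frac{z^n}{n!}\,\frac{m_\lambda}{\lambda!},$$ where $m_\lambda$ is the monomial symmetric function in $x_1,x_2,\dots$ and $\lambda!=\lambda_1!\lambda_2!\cdots$. *)

theory Defs
  imports
    Complex_Main
    "Jordan_Normal_Form.Missing_VectorSpace"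
    "HOL-Algebra.AbelCoset"
    "HOL-Library.Disjoint_Sets"
    "HOL-Library.Nat_Bijection"
    "HOL-Library.Poly_Mapping"
    "HOL-Library.Product_Plus"
begin

section \<open>Pointed partitions\<close>

text \<open>
  The finite sets are taken to be the finite subsets of \<^typ>\<open>nat\<close>, where a natural number is
  identified with a hereditarily finite set through the Ackermann coding \<^const>\<open>set_encode\<close>.
  This is a full subcategory equivalent to all finite sets, and it is closed under passing to
  the set of blocks of a partition: the block \<^term>\<open>s\<close>, seen as a point, is \<^term>\<open>set_encode s\<close>.
\<close>

datatype ppart = PPart (marked: "nat set") (parts: "nat set set")

definition ground :: "ppart \<Rightarrow> nat set" where
  "ground J = marked J \<union> \<Union>(parts J)"

definition pointed_partition :: "ppart \<Rightarrow> bool" where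
  "pointed_partition J \<longleftrightarrow>
     finite (ground J) \<and> partition_on (ground J - marked J) (parts J)"

text \<open>Bijections are represented by their extensional representatives, so that a morphism is
  determined by its values on the underlying set.\<close>

definition pp_hom :: "ppart \<Rightarrow> ppart \<Rightarrow> (nat \<Rightarrow> nat) set" where
  "pp_hom J J' = {f \<in> extensional (ground J).
     bij_betw f (ground J) (ground J') \<and>
     f ` marked J = marked J' \<and> (\<lambda>A. f ` A) ` parts J = parts J'}"

definition induced :: "ppart \<Rightarrow> nat set \<Rightarrow> ppart" where
  "induced J S = PPart (marked J \<inter> S) ((\<lambda>A. A \<inter> S) ` parts J - {{}})"

definition contracted :: "ppart \<Rightarrow> nat set set \<Rightarrow> ppart" where
  "contracted J I = PPart
     (set_encode ` {s \<in> I. card s = 1 \<and> s \<subseteq> marked J \<or> card s > 1})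
     ((\<lambda>A. set_encode ` {s \<in> I. card s = 1 \<and> s \<subseteq> A}) ` parts J - {{}})"

definition contracted_map :: "nat set set \<Rightarrow> (nat \<Rightarrow> nat) \<Rightarrow> nat \<Rightarrow> nat" where
  "contracted_map I f = (\<lambda>c \<in> set_encode ` I. set_encode (f ` set_decode c))"


section \<open>Direct sums and tensor products of vector spaces\<close>

definition finite_direct_sum :: "'i set \<Rightarrow> ('i \<Rightarrow> ('k, 'v) module) \<Rightarrow> ('k, 'i \<Rightarrow> 'v) module" where
  "finite_direct_sum S V =
     \<lparr>carrier = (\<Pi>\<^sub>E i\<in>S. carrier (V i)),
      mult = undefined, one = undefined,
      zero = (\<lambda>i\<in>S. \<zero>\<^bsub>V i\<^esub>),
      add = (\<lambda>v w. \<lambda>i\<in>S. v i \<oplus>\<^bsub>V i\<^esub> w i),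
      smult = (\<lambda>c v. \<lambda>i\<in>S. c \<odot>\<^bsub>V i\<^esub> v i)\<rparr>"

definition free_space :: "'k ring \<Rightarrow> 'x set \<Rightarrow> ('k, 'x \<Rightarrow> 'k) module" where
  "free_space K X = (ring.func_space K X)
     \<lparr>carrier := {\<phi> \<in> X \<rightarrow>\<^sub>E carrier K. finite {x \<in> X. \<phi> x \<noteq> \<zero>\<^bsub>K\<^esub>}}\<rparr>"

definition free_gen :: "'k ring \<Rightarrow> 'x set \<Rightarrow> 'x \<Rightarrow> 'x \<Rightarrow> 'k" where
  "free_gen K X x = (\<lambda>y\<in>X. if y = x then \<one>\<^bsub>K\<^esub> else \<zero>\<^bsub>K\<^esub>)"

text \<open>The linear map between free spaces that extends a map \<^term>\<open>h\<close> of the generators.\<close>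

definition free_map :: "'k ring \<Rightarrow> 'x set \<Rightarrow> 'y set \<Rightarrow> ('x \<Rightarrow> 'y) \<Rightarrow> ('x \<Rightarrow> 'k) \<Rightarrow> 'y \<Rightarrow> 'k" where
  "free_map K X Y h \<phi> = (\<lambda>y\<in>Y. \<Oplus>\<^bsub>K\<^esub>x\<in>{x \<in> X. \<phi> x \<noteq> \<zero>\<^bsub>K\<^esub> \<and> h x = y}. \<phi> x)"

definition quotient_space :: "('k, 'v) module \<Rightarrow> 'v set \<Rightarrow> ('k, 'v set) module" where
  "quotient_space M N =
     \<lparr>carrier = a_rcosets\<^bsub>M\<^esub> N,
      mult = undefined, one = undefined,
      zero = N,
      add = (\<lambda>A B. A <+>\<^bsub>M\<^esub> B),
      smult = (\<lambda>c A. \<Union>a\<in>A. N +>\<^bsub>M\<^esub> (c \<odot>\<^bsub>M\<^esub> a))\<rparr>"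

text \<open>The map into a quotient of \<^term>\<open>M\<close> by \<^term>\<open>N\<close> that a map \<^term>\<open>g\<close> into \<^term>\<open>M\<close>
  induces on cosets.\<close>

definition quotient_map :: "('k, 'v) module \<Rightarrow> 'v set \<Rightarrow> ('u \<Rightarrow> 'v) \<Rightarrow> 'u set \<Rightarrow> 'v set" where
  "quotient_map M N g A = (\<Union>a\<in>A. N +>\<^bsub>M\<^esub> g a)"

text \<open>Tensor product of two vector spaces: the free space on pairs modulo bilinearity.\<close>

definition pairs :: "('k, 'v) module \<Rightarrow> ('k, 'w) module \<Rightarrow> ('v \<times> 'w) set" where
  "pairs V W = carrier V \<times> carrier W"

definition bilinear_relations ::
    "'k ring \<Rightarrow> ('k, 'v) module \<Rightarrow> ('k, 'w) module \<Rightarrow> ('v \<times> 'w \<Rightarrow> 'k) set" where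
  "bilinear_relations K V W =
     (let F = free_space K (pairs V W); \<delta> = free_gen K (pairs V W) in
      {\<delta> (v \<oplus>\<^bsub>V\<^esub> v', w) \<ominus>\<^bsub>F\<^esub> (\<delta> (v, w) \<oplus>\<^bsub>F\<^esub> \<delta> (v', w)) | v v' w.
         v \<in> carrier V \<and> v' \<in> carrier V \<and> w \<in> carrier W} \<union>
      {\<delta> (v, w \<oplus>\<^bsub>W\<^esub> w') \<ominus>\<^bsub>F\<^esub> (\<delta> (v, w) \<oplus>\<^bsub>F\<^esub> \<delta> (v, w')) | v w w'.
         v \<in> carrier V \<and> w \<in> carrier W \<and> w' \<in> carrier W} \<union>
      {\<delta> (c \<odot>\<^bsub>V\<^esub> v, w) \<ominus>\<^bsub>F\<^esub> c \<odot>\<^bsub>F\<^esub> \<delta> (v, w) | c v w.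
         c \<in> carrier K \<and> v \<in> carrier V \<and> w \<in> carrier W} \<union>
      {\<delta> (v, c \<odot>\<^bsub>W\<^esub> w) \<ominus>\<^bsub>F\<^esub> c \<odot>\<^bsub>F\<^esub> \<delta> (v, w) | c v w.
         c \<in> carrier K \<and> v \<in> carrier V \<and> w \<in> carrier W})"

definition bilinear_kernel ::
    "'k ring \<Rightarrow> ('k, 'v) module \<Rightarrow> ('k, 'w) module \<Rightarrow> ('v \<times> 'w \<Rightarrow> 'k) set" where
  "bilinear_kernel K V W = module.span K (free_space K (pairs V W)) (bilinear_relations K V W)"

definition tensor ::
    "'k ring \<Rightarrow> ('k, 'v) module \<Rightarrow> ('k, 'w) module \<Rightarrow> ('k, ('v \<times> 'w \<Rightarrow> 'k) set) module" where
  "tensor K V W = quotient_space (free_space K (pairs V W)) (bilinear_kernel K V W)"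

definition tensor_map ::
    "'k ring \<Rightarrow> ('k, 'v) module \<Rightarrow> ('k, 'w) module \<Rightarrow> ('k, 'v2) module \<Rightarrow> ('k, 'w2) module \<Rightarrow>
     ('v \<Rightarrow> 'v2) \<Rightarrow> ('w \<Rightarrow> 'w2) \<Rightarrow> ('v \<times> 'w \<Rightarrow> 'k) set \<Rightarrow> ('v2 \<times> 'w2 \<Rightarrow> 'k) set" where
  "tensor_map K V W V2 W2 f g =
     quotient_map (free_space K (pairs V2 W2)) (bilinear_kernel K V2 W2)
       (free_map K (pairs V W) (pairs V2 W2) (\<lambda>(v, w). (f v, g w)))"

text \<open>Tensor product of a family indexed by a finite set: the free space on the tuples modulo
  multilinearity. The empty tensor product is the free space on one generator.\<close>

definition tuples :: "'i set \<Rightarrow> ('i \<Rightarrow> ('k, 'v) module) \<Rightarrow> ('i \<Rightarrow> 'v) set" where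
  "tuples S V = (\<Pi>\<^sub>E i\<in>S. carrier (V i))"

definition multilinear_relations ::
    "'k ring \<Rightarrow> 'i set \<Rightarrow> ('i \<Rightarrow> ('k, 'v) module) \<Rightarrow> (('i \<Rightarrow> 'v) \<Rightarrow> 'k) set" where
  "multilinear_relations K S V =
     (let F = free_space K (tuples S V); \<delta> = free_gen K (tuples S V) in
      {\<delta> (x(i := v \<oplus>\<^bsub>V i\<^esub> w)) \<ominus>\<^bsub>F\<^esub> (\<delta> (x(i := v)) \<oplus>\<^bsub>F\<^esub> \<delta> (x(i := w))) | x i v w.
         x \<in> tuples S V \<and> i \<in> S \<and> v \<in> carrier (V i) \<and> w \<in> carrier (V i)} \<union>
      {\<delta> (x(i := c \<odot>\<^bsub>V i\<^esub> v)) \<ominus>\<^bsub>F\<^esub> c \<odot>\<^bsub>F\<^esub> \<delta> (x(i := v)) | x i c v.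
         x \<in> tuples S V \<and> i \<in> S \<and> c \<in> carrier K \<and> v \<in> carrier (V i)})"

definition multilinear_kernel ::
    "'k ring \<Rightarrow> 'i set \<Rightarrow> ('i \<Rightarrow> ('k, 'v) module) \<Rightarrow> (('i \<Rightarrow> 'v) \<Rightarrow> 'k) set" where
  "multilinear_kernel K S V =
     module.span K (free_space K (tuples S V)) (multilinear_relations K S V)"

definition tensor_family ::
    "'k ring \<Rightarrow> 'i set \<Rightarrow> ('i \<Rightarrow> ('k, 'v) module) \<Rightarrow> ('k, (('i \<Rightarrow> 'v) \<Rightarrow> 'k) set) module" where
  "tensor_family K S V = quotient_space (free_space K (tuples S V)) (multilinear_kernel K S V)"

text \<open>For a bijection \<^term>\<open>r\<close> from \<^term>\<open>S2\<close> onto \<^term>\<open>S\<close> and linear maps \<^term>\<open>g i\<close> from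
  \<^term>\<open>V (r i)\<close> to \<^term>\<open>V2 i\<close>, the induced map between the tensor products.\<close>

definition tensor_family_map ::
    "'k ring \<Rightarrow> 'i set \<Rightarrow> ('i \<Rightarrow> ('k, 'v) module) \<Rightarrow> 'j set \<Rightarrow> ('j \<Rightarrow> ('k, 'w) module) \<Rightarrow>
     ('j \<Rightarrow> 'i) \<Rightarrow> ('j \<Rightarrow> 'v \<Rightarrow> 'w) \<Rightarrow> (('i \<Rightarrow> 'v) \<Rightarrow> 'k) set \<Rightarrow> (('j \<Rightarrow> 'w) \<Rightarrow> 'k) set" where
  "tensor_family_map K S V S2 V2 r g =
     quotient_map (free_space K (tuples S2 V2)) (multilinear_kernel K S2 V2)
       (free_map K (tuples S V) (tuples S2 V2) (\<lambda>x. \<lambda>i\<in>S2. g i (x (r i))))"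


section \<open>Pointed multi-symmetric collections\<close>

record ('k, 'v) collection =
  obj :: "ppart \<Rightarrow> ('k, 'v) module"
  mor :: "ppart \<Rightarrow> ppart \<Rightarrow> (nat \<Rightarrow> nat) \<Rightarrow> 'v \<Rightarrow> 'v"

text \<open>Contravariance: a morphism from \<^term>\<open>J\<close> to \<^term>\<open>J'\<close> acts from the value on \<^term>\<open>J'\<close>
  to the value on \<^term>\<open>J\<close>.\<close>

locale pointed_collection = field K for K :: "'k ring" (structure) +
  fixes P :: "('k, 'v) collection"
  assumes vectorspace_obj: "pointed_partition J \<Longrightarrow> vectorspace K (obj P J)"
    and fin_dim_obj: "pointed_partition J \<Longrightarrow> vectorspace.fin_dim K (obj P J)"
    and linear_mor: "\<lbrakk>pointed_partition J; pointed_partition J'; f \<in> pp_hom J J'\<rbrakk> \<Longrightarrow>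
          linear_map K (obj P J') (obj P J) (mor P J J' f)"
    and mor_id: "\<lbrakk>pointed_partition J; v \<in> carrier (obj P J)\<rbrakk> \<Longrightarrow>
          mor P J J (\<lambda>x\<in>ground J. x) v = v"
    and mor_comp: "\<lbrakk>pointed_partition J; pointed_partition J'; pointed_partition J'';
          f \<in> pp_hom J J'; g \<in> pp_hom J' J''; v \<in> carrier (obj P J'')\<rbrakk> \<Longrightarrow>
          mor P J J'' (compose (ground J) g f) v = mor P J J' f (mor P J' J'' g v)"

text \<open>Both pointed partitions of a one-element set are meant, the one in which the point is
  marked and the one in which it forms an unmarked part. In the contraction product this makes
  the tensor factor of a one-element block the unit.\<close>

locale connected_collection = pointed_collection +
  assumes dim_singleton: "\<lbrakk>pointed_partition J; card (ground J) = 1\<rbrakk> \<Longrightarrow>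
          vectorspace.dim K (obj P J) = 1"

definition contraction_summand ::
    "'k ring \<Rightarrow> ('k, 'v) collection \<Rightarrow> ('k, 'w) collection \<Rightarrow> ppart \<Rightarrow> nat set set \<Rightarrow>
     ('k, ('v \<times> ((nat set \<Rightarrow> 'w) \<Rightarrow> 'k) set \<Rightarrow> 'k) set) module" where
  "contraction_summand K P Q J I =
     tensor K (obj P (contracted J I)) (tensor_family K I (\<lambda>s. obj Q (induced J s)))"

definition contraction_summand_map ::
    "'k ring \<Rightarrow> ('k, 'v) collection \<Rightarrow> ('k, 'w) collection \<Rightarrow> ppart \<Rightarrow> ppart \<Rightarrow> (nat \<Rightarrow> nat) \<Rightarrow>
     nat set set \<Rightarrow>
     ('v \<times> ((nat set \<Rightarrow> 'w) \<Rightarrow> 'k) set \<Rightarrow> 'k) set \<Rightarrow> ('v \<times> ((nat set \<Rightarrow> 'w) \<Rightarrow> 'k) set \<Rightarrow> 'k) set" where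
  "contraction_summand_map K P Q J J' f I =
     (let I' = (\<lambda>s. f ` s) ` I;
          W = (\<lambda>s. obj Q (induced J s));
          W' = (\<lambda>s. obj Q (induced J' s))
      in tensor_map K
           (obj P (contracted J' I')) (tensor_family K I' W')
           (obj P (contracted J I)) (tensor_family K I W)
           (mor P (contracted J I) (contracted J' I') (contracted_map I f))
           (tensor_family_map K I' W' I W (\<lambda>s. f ` s)
             (\<lambda>s. mor Q (induced J s) (induced J' (f ` s)) (restrict f s))))"

definition contraction_product ::
    "'k ring \<Rightarrow> ('k, 'v) collection \<Rightarrow> ('k, 'w) collection \<Rightarrow>
     ('k, nat set set \<Rightarrow> ('v \<times> ((nat set \<Rightarrow> 'w) \<Rightarrow> 'k) set \<Rightarrow> 'k) set) collection" where
  "contraction_product K P Q =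
     \<lparr>obj = (\<lambda>J. finite_direct_sum {I. partition_on (ground J) I} (contraction_summand K P Q J)),
      mor = (\<lambda>J J' f v. \<lambda>I\<in>{I. partition_on (ground J) I}.
               contraction_summand_map K P Q J J' f I (v ((\<lambda>s. f ` s) ` I)))\<rparr>"


text \<open>The values of the contraction product are vector spaces.\<close>

lemma free_space_vectorspace:
  assumes "field K"
  shows "vectorspace K (free_space K X)"
proof -
  interpret K: field K by fact
  interpret F: module K "K.func_space X" by (rule K.func_space_is_module)
  have "submodule K {\<phi> \<in> X \<rightarrow>\<^sub>E carrier K. finite {x \<in> X. \<phi> x \<noteq> \<zero>\<^bsub>K\<^esub>}} (K.func_space X)"
  proof (rule submodule.intro, rule F.module_axioms, goal_cases)
    case 1 show ?case by (auto simp: K.func_space_def)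
  next
    case (2 v w)
    have "{x \<in> X. v x \<oplus>\<^bsub>K\<^esub> w x \<noteq> \<zero>\<^bsub>K\<^esub>} \<subseteq> {x \<in> X. v x \<noteq> \<zero>\<^bsub>K\<^esub>} \<union> {x \<in> X. w x \<noteq> \<zero>\<^bsub>K\<^esub>}"
      by auto
    with 2 have "finite {x \<in> X. v x \<oplus>\<^bsub>K\<^esub> w x \<noteq> \<zero>\<^bsub>K\<^esub>}"
      by (elim finite_subset) auto
    moreover have "{x \<in> X. (v \<oplus>\<^bsub>K.func_space X\<^esub> w) x \<noteq> \<zero>\<^bsub>K\<^esub>} = {x \<in> X. v x \<oplus>\<^bsub>K\<^esub> w x \<noteq> \<zero>\<^bsub>K\<^esub>}"
      by (auto simp: K.func_space_def)
    ultimately show ?case using 2 by (auto simp: K.func_space_def)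
  next
    case 3 show ?case
      by (auto simp: K.func_space_def cong: conj_cong)
  next
    case (4 c v)
    then have "finite {x \<in> X. c \<otimes>\<^bsub>K\<^esub> v x \<noteq> \<zero>\<^bsub>K\<^esub>}"
      by (elim CollectE conjE finite_subset[rotated]) auto
    moreover have "{x \<in> X. (c \<odot>\<^bsub>K.func_space X\<^esub> v) x \<noteq> \<zero>\<^bsub>K\<^esub>} = {x \<in> X. c \<otimes>\<^bsub>K\<^esub> v x \<noteq> \<zero>\<^bsub>K\<^esub>}"
      by (auto simp: K.func_space_def)
    ultimately show ?case using 4 by (auto simp: K.func_space_def)
  qed
  from F.submodule_is_module[OF this] show ?thesis
    by (simp add: vectorspace_def free_space_def assms)
qed

lemma quotient_space_vectorspace:
  assumes "vectorspace K M" "submodule K N M"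
  shows "vectorspace K (quotient_space M N)"
proof -
  interpret M: vectorspace K M by fact
  interpret N: submodule K N M by fact
  let ?Q = "quotient_space M N"
  have sg: "additive_subgroup N M"
  proof (rule additive_subgroup.intro, rule subgroup.intro)
    fix x assume "x \<in> N"
    have "\<ominus>\<^bsub>M\<^esub> x = (\<ominus>\<^bsub>K\<^esub> \<one>\<^bsub>K\<^esub>) \<odot>\<^bsub>M\<^esub> x"
      using M.smult_minus_1 N.subset \<open>x \<in> N\<close> by auto
    then show "inv\<^bsub>add_monoid M\<^esub> x \<in> N"
      using \<open>x \<in> N\<close> by (simp add: a_inv_def)
  qed (use N.subset in auto)
  interpret N: abelian_subgroup N M
    by (rule abelian_subgroupI3) (auto intro: sg M.abelian_group_axioms)
  have sm: "c \<odot>\<^bsub>?Q\<^esub> (N +>\<^bsub>M\<^esub> a) = N +>\<^bsub>M\<^esub> (c \<odot>\<^bsub>M\<^esub> a)"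
    if "c \<in> carrier K" "a \<in> carrier M" for c a
  proof -
    have "N +>\<^bsub>M\<^esub> (c \<odot>\<^bsub>M\<^esub> b) = N +>\<^bsub>M\<^esub> (c \<odot>\<^bsub>M\<^esub> a)" if b: "b \<in> N +>\<^bsub>M\<^esub> a" for b
    proof -
      from b obtain n where n: "n \<in> N" "b = n \<oplus>\<^bsub>M\<^esub> a"
        by (auto simp: a_r_coset_def')
      then have "c \<odot>\<^bsub>M\<^esub> b = c \<odot>\<^bsub>M\<^esub> n \<oplus>\<^bsub>M\<^esub> c \<odot>\<^bsub>M\<^esub> a"
        using that \<open>a \<in> carrier M\<close> \<open>c \<in> carrier K\<close> N.subset by (auto simp: M.smult_r_distr)
      then have "c \<odot>\<^bsub>M\<^esub> b \<in> N +>\<^bsub>M\<^esub> (c \<odot>\<^bsub>M\<^esub> a)"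
        using n \<open>c \<in> carrier K\<close> by (auto simp: a_r_coset_def')
      then show ?thesis
        using \<open>a \<in> carrier M\<close> \<open>c \<in> carrier K\<close> N.a_repr_independence' by auto
    qed
    moreover have "a \<in> N +>\<^bsub>M\<^esub> a" using \<open>a \<in> carrier M\<close> N.a_rcos_self by auto
    ultimately have "(\<Union>b\<in>N +>\<^bsub>M\<^esub> a. N +>\<^bsub>M\<^esub> (c \<odot>\<^bsub>M\<^esub> b)) = N +>\<^bsub>M\<^esub> (c \<odot>\<^bsub>M\<^esub> a)"
      by (intro SUP_eq_const) blast+
    then show ?thesis by (simp add: quotient_space_def)
  qed
  have car: "carrier ?Q = (\<lambda>a. N +>\<^bsub>M\<^esub> a) ` carrier M"
    by (auto simp: quotient_space_def A_RCOSETS_def')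
  have ad: "(N +>\<^bsub>M\<^esub> a) \<oplus>\<^bsub>?Q\<^esub> (N +>\<^bsub>M\<^esub> b) = N +>\<^bsub>M\<^esub> (a \<oplus>\<^bsub>M\<^esub> b)"
    if "a \<in> carrier M" "b \<in> carrier M" for a b
    using that N.a_rcos_sum by (simp add: quotient_space_def)
  have ze: "\<zero>\<^bsub>?Q\<^esub> = N +>\<^bsub>M\<^esub> \<zero>\<^bsub>M\<^esub>"
    using M.M.a_coset_add_zero[OF N.a_subset] by (simp add: quotient_space_def)
  have "abelian_group ?Q"
  proof (rule abelian_groupI, goal_cases)
    case (6 x)
    then obtain a where a: "a \<in> carrier M" "x = N +>\<^bsub>M\<^esub> a" by (auto simp: car)
    have "(N +>\<^bsub>M\<^esub> (\<ominus>\<^bsub>M\<^esub> a)) \<oplus>\<^bsub>?Q\<^esub> x = \<zero>\<^bsub>?Q\<^esub>"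
      using a by (simp add: ad ze M.M.l_neg)
    then show ?case using a(1) by (auto simp: car intro!: bexI)
  qed (auto simp: car ad ze M.M.a_assoc M.M.a_comm M.M.a_lcomm)
  then have "module K ?Q"
    by (intro moduleI M.is_cring)
       (auto simp: car ad ze sm M.smult_l_distr M.smult_r_distr M.smult_assoc1)
  then show ?thesis by (simp add: vectorspace_def M.field_axioms)
qed

lemma finite_direct_sum_vectorspace:
  assumes K: "field K" and V: "\<And>i. i \<in> S \<Longrightarrow> vectorspace K (V i)"
  shows "vectorspace K (finite_direct_sum S V)"
proof -
  interpret K: field K by fact
  have m: "module K (V i)" if "i \<in> S" for i using V[OF that] by (simp add: vectorspace_def)
  have g: "abelian_group (V i)" if "i \<in> S" for i using m[OF that] by (rule module.axioms)
  let ?D = "finite_direct_sum S V"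
  note [simp] = finite_direct_sum_def
  have "abelian_group ?D"
  proof (rule abelian_groupI, goal_cases)
    case (1 x y) then show ?case
      using abelian_group.axioms(1)[OF g] by (auto intro!: abelian_monoid.a_closed[of "V _"])
  next
    case 2 show ?case
      using abelian_group.axioms(1)[OF g] by (auto intro!: abelian_monoid.zero_closed[of "V _"])
  next
    case (3 x y z) then show ?case
      using abelian_group.axioms(1)[OF g]
      by (auto intro!: restrict_ext abelian_monoid.a_assoc[of "V _"])
  next
    case (4 x y) then show ?case
      using abelian_group.axioms(1)[OF g]
      by (auto intro!: restrict_ext abelian_monoid.a_comm[of "V _"])
  next
    case (5 x) then show ?case
      using abelian_group.axioms(1)[OF g] abelian_monoid.l_zero[of "V _"]
      by (auto intro!: extensionalityI[of _ S] simp: PiE_def Pi_def)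
  next
    case (6 x)
    let ?y = "\<lambda>i\<in>S. \<ominus>\<^bsub>V i\<^esub> x i"
    have "?y \<in> carrier ?D"
      using 6 g by (auto intro!: abelian_group.a_inv_closed[of "V _"])
    moreover have "?y \<oplus>\<^bsub>?D\<^esub> x = \<zero>\<^bsub>?D\<^esub>"
      using 6 g by (auto intro!: restrict_ext abelian_group.l_neg[of "V _"])
    ultimately show ?case by blast
  qed
  then have "module K ?D"
  proof (intro moduleI K.is_cring, goal_cases)
    case (2 a x) then show ?case using m by (auto intro!: module.smult_closed[of K "V _"])
  next
    case (3 a b x) then show ?case
      using m by (auto intro!: restrict_ext module.smult_l_distr[of K "V _"])
  next
    case (4 a x y) then show ?case
      using m by (auto intro!: restrict_ext module.smult_r_distr[of K "V _"])
  next
    case (5 a b x) then show ?case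
      using m by (auto intro!: restrict_ext module.smult_assoc1[of K "V _"])
  next
    case (6 x) then show ?case
      using m module.smult_one[of K "V _"]
      by (auto intro!: extensionalityI[of _ S] simp: PiE_def Pi_def)
  qed auto
  then show ?thesis by (simp add: vectorspace_def K)
qed

lemma free_gen_in_carrier:
  assumes "field K" "x \<in> X"
  shows "free_gen K X x \<in> carrier (free_space K X)"
proof -
  interpret K: field K by fact
  have "{y \<in> X. free_gen K X x y \<noteq> \<zero>\<^bsub>K\<^esub>} \<subseteq> {x}" by (auto simp: free_gen_def)
  then show ?thesis
    by (auto simp: free_space_def free_gen_def intro: finite_subset)
qed

lemma bilinear_relations_subset:
  assumes "vectorspace K V" "vectorspace K W"
  shows "bilinear_relations K V W \<subseteq> carrier (free_space K (pairs V W))"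
proof -
  interpret V: vectorspace K V by fact
  interpret W: vectorspace K W by fact
  interpret F: vectorspace K "free_space K (pairs V W)"
    by (rule free_space_vectorspace) (rule V.field_axioms)
  have g: "free_gen K (pairs V W) (v, w) \<in> carrier (free_space K (pairs V W))"
    if "v \<in> carrier V" "w \<in> carrier W" for v w
    by (rule free_gen_in_carrier) (use that V.field_axioms in \<open>auto simp: pairs_def\<close>)
  show ?thesis
    unfolding bilinear_relations_def Let_def by (auto intro!: F.M.minus_closed g)
qed

lemma tensor_vectorspace:
  assumes "vectorspace K V" "vectorspace K W"
  shows "vectorspace K (tensor K V W)"
proof -
  interpret V: vectorspace K V by fact
  interpret F: vectorspace K "free_space K (pairs V W)"
    by (rule free_space_vectorspace) (rule V.field_axioms)
  show ?thesis
    unfolding tensor_def bilinear_kernel_def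
    by (intro quotient_space_vectorspace F.span_is_submodule bilinear_relations_subset assms)
       (rule F.vectorspace_axioms)
qed

lemma multilinear_relations_subset:
  assumes "field K" "\<And>i. i \<in> S \<Longrightarrow> vectorspace K (V i)"
  shows "multilinear_relations K S V \<subseteq> carrier (free_space K (tuples S V))"
proof -
  interpret F: vectorspace K "free_space K (tuples S V)"
    by (rule free_space_vectorspace) fact
  have m: "module K (V i)" if "i \<in> S" for i using assms(2)[OF that] by (simp add: vectorspace_def)
  have ab: "abelian_monoid (V i)" if "i \<in> S" for i
    using m[OF that] abelian_group.axioms(1) module.axioms(2) by blast
  have g: "free_gen K (tuples S V) (x(i := v)) \<in> carrier (free_space K (tuples S V))"
    if "x \<in> tuples S V" "i \<in> S" "v \<in> carrier (V i)" for x i v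
    by (rule free_gen_in_carrier) (use that assms(1) in \<open>auto simp: tuples_def PiE_iff extensional_def\<close>)
  show ?thesis
    unfolding multilinear_relations_def Let_def
    by (auto intro!: F.M.minus_closed g F.M.a_closed F.smult_closed abelian_monoid.a_closed[OF ab]
          module.smult_closed[OF m])
qed

lemma tensor_family_vectorspace:
  assumes "field K" "\<And>i. i \<in> S \<Longrightarrow> vectorspace K (V i)"
  shows "vectorspace K (tensor_family K S V)"
proof -
  interpret F: vectorspace K "free_space K (tuples S V)"
    by (rule free_space_vectorspace) fact
  show ?thesis
    unfolding tensor_family_def multilinear_kernel_def
    by (intro quotient_space_vectorspace F.span_is_submodule multilinear_relations_subset assms)
       (rule F.vectorspace_axioms)
qed

lemma pointed_partition_induced:
  assumes "pointed_partition J"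
  shows "pointed_partition (induced J S)" "ground (induced J S) = ground J \<inter> S"
proof -
  have J: "finite (ground J)" "\<Union>(parts J) = ground J - marked J"
    "\<And>A B. \<lbrakk>A \<in> parts J; B \<in> parts J; A \<noteq> B\<rbrakk> \<Longrightarrow> A \<inter> B = {}"
    using assms by (auto simp: pointed_partition_def partition_on_def disjoint_def)
  show g: "ground (induced J S) = ground J \<inter> S" by (auto simp: ground_def induced_def)
  have "\<Union>(parts (induced J S)) = \<Union>(parts J) \<inter> S" by (auto simp: induced_def)
  then have u: "\<Union>(parts (induced J S)) = ground (induced J S) - marked (induced J S)"
    unfolding g J(2) by (auto simp: induced_def)
  have d: "disjoint (parts (induced J S))"
  proof (rule disjointI)
    fix a b assume "a \<in> parts (induced J S)" "b \<in> parts (induced J S)" and ne: "a \<noteq> b"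
    then obtain A B where "A \<in> parts J" "a = A \<inter> S" "B \<in> parts J" "b = B \<inter> S"
      by (auto simp: induced_def)
    with J(3)[of A B] ne show "a \<inter> b = {}" by blast
  qed
  show "pointed_partition (induced J S)"
    unfolding pointed_partition_def partition_on_def
  proof (intro conjI u d)
    show "finite (ground (induced J S))" using J(1) g by simp
    show "{} \<notin> parts (induced J S)" by (simp add: induced_def)
  qed
qed

lemma pointed_partition_contracted:
  assumes J: "pointed_partition J" and I: "partition_on (ground J) I"
  shows "pointed_partition (contracted J I)" "ground (contracted J I) = set_encode ` I"
proof -
  have fin: "finite s" "s \<noteq> {}" "s \<subseteq> ground J" if "s \<in> I" for s
    using that I J finite_subset[of s "ground J"] by (auto simp: partition_on_def pointed_partition_def)
  have inj: "inj_on set_encode I"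
    by (rule inj_on_subset[OF inj_on_set_encode]) (use fin in auto)
  have finI: "finite I"
    using J I finite_elements by (auto simp: pointed_partition_def)
  have cov: "(card s = 1 \<and> s \<subseteq> marked J \<or> card s > 1) \<or> (\<exists>A\<in>parts J. card s = 1 \<and> s \<subseteq> A)"
    if "s \<in> I" for s
  proof -
    have "card s > 0" using fin[OF that] by (simp add: card_gt_0_iff)
    moreover have "s \<subseteq> marked J \<or> (\<exists>A\<in>parts J. s \<subseteq> A)" if "card s = 1"
    proof -
      from that obtain t where "s = {t}" by (rule card_1_singletonE)
      then show ?thesis using fin(3)[OF \<open>s \<in> I\<close>] by (auto simp: ground_def)
    qed
    ultimately show ?thesis by (cases "card s = 1") auto
  qed
  show g: "ground (contracted J I) = set_encode ` I"
  proof -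
    have "ground (contracted J I) = set_encode ` ({s \<in> I. card s = 1 \<and> s \<subseteq> marked J \<or> card s > 1}
        \<union> (\<Union>A\<in>parts J. {s \<in> I. card s = 1 \<and> s \<subseteq> A}))"
      by (auto simp: ground_def contracted_def)
    also have "{s \<in> I. card s = 1 \<and> s \<subseteq> marked J \<or> card s > 1}
        \<union> (\<Union>A\<in>parts J. {s \<in> I. card s = 1 \<and> s \<subseteq> A}) = I"
      using cov by blast
    finally show ?thesis .
  qed
  have dj: False if "s \<in> I" "s \<subseteq> A" "s \<subseteq> B" "A \<inter> B = {}" for s A B
    using that fin(2)[OF that(1)] by blast
  have mJ: "marked J \<inter> A = {}" if "A \<in> parts J" for A
    using J that by (auto simp: pointed_partition_def partition_on_def)
  have pJ: "A \<inter> B = {}" if "A \<in> parts J" "B \<in> parts J" "A \<noteq> B" for A B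
    using J that by (auto simp: pointed_partition_def partition_on_def disjoint_def)
  have m: "marked (contracted J I) \<inter> \<Union>(parts (contracted J I)) = {}"
  proof -
    have False if c: "c \<in> marked (contracted J I)" "c \<in> C" "C \<in> parts (contracted J I)" for c C
    proof -
      obtain s where s: "s \<in> I" "card s = 1 \<and> s \<subseteq> marked J \<or> card s > 1" "c = set_encode s"
        using c(1) by (auto simp: contracted_def)
      obtain A s' where s': "A \<in> parts J" "s' \<in> I" "card s' = 1" "s' \<subseteq> A" "c = set_encode s'"
        using c(2,3) by (auto simp: contracted_def)
      have "s = s'" using s s' inj by (metis inj_onD)
      then show False using s s' dj[OF s(1) _ _ mJ[OF s'(1)]] by auto
    qed
    then show ?thesis by blast
  qed
  have d: "disjoint (parts (contracted J I))"
  proof (rule disjointI)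
    fix a b assume "a \<in> parts (contracted J I)" "b \<in> parts (contracted J I)" and ne: "a \<noteq> b"
    then obtain A B where A: "A \<in> parts J" "a = set_encode ` {s \<in> I. card s = 1 \<and> s \<subseteq> A}"
      and B: "B \<in> parts J" "b = set_encode ` {s \<in> I. card s = 1 \<and> s \<subseteq> B}"
      by (auto simp: contracted_def)
    have AB: "A \<inter> B = {}" using A B ne pJ by blast
    have False if "c \<in> a" "c \<in> b" for c
    proof -
      from that(1) A obtain s where s: "s \<in> I" "s \<subseteq> A" "c = set_encode s" by auto
      from that(2) B obtain s' where s': "s' \<in> I" "s' \<subseteq> B" "c = set_encode s'" by auto
      have "s = s'" using s s' inj by (metis inj_onD)
      then show False using dj[OF s(1,2) _ AB] s' by auto
    qed
    then show "a \<inter> b = {}" by blast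
  qed
  show "pointed_partition (contracted J I)"
    unfolding pointed_partition_def partition_on_def
  proof (intro conjI d)
    show "finite (ground (contracted J I))" using g finI by simp
    show "\<Union>(parts (contracted J I)) = ground (contracted J I) - marked (contracted J I)"
      using m by (auto simp: ground_def)
    show "{} \<notin> parts (contracted J I)" by (simp add: contracted_def)
  qed
qed

lemma contraction_product_vectorspace:
  assumes "pointed_collection K P" "pointed_collection K Q" "pointed_partition J"
  shows "vectorspace K (obj (contraction_product K P Q) J)"
proof -
  have f: "field K" using assms(1) by (simp add: pointed_collection_def)
  have "vectorspace K (contraction_summand K P Q J I)" if "partition_on (ground J) I" for I
    unfolding contraction_summand_def
    by (intro tensor_vectorspace tensor_family_vectorspace f
        pointed_collection.vectorspace_obj[OF assms(1)] pointed_collection.vectorspace_obj[OF assms(2)]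
        pointed_partition_contracted pointed_partition_induced assms that)
  then show ?thesis
    by (auto simp: contraction_product_def intro!: finite_direct_sum_vectorspace[OF f])
qed


section \<open>Power series in \<open>z\<close> and infinitely many variables\<close>

text \<open>A formal power series is its coefficient function. The exponent \<open>(n, \<alpha>)\<close> stands for the
  monomial in which \<open>z\<close> has exponent \<open>n\<close> and the \<open>i\<close>-th variable \<open>x\<close> has exponent \<open>\<alpha>(i)\<close>
  (the variables \<open>x\<close> are numbered from \<open>0\<close>).\<close>

type_synonym exponent = "nat \<times> (nat \<Rightarrow>\<^sub>0 nat)"
type_synonym series = "exponent \<Rightarrow> rat"

definition series_one :: series where
  "series_one e = of_bool (e = 0)"

definition series_mult :: "series \<Rightarrow> series \<Rightarrow> series" where
  "series_mult F G e = (\<Sum>(a, b) | a + b = e. F a * G b)"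

definition series_power :: "series \<Rightarrow> nat \<Rightarrow> series" where
  "series_power F n = (series_mult F ^^ n) series_one"

definition z_coeff :: "series \<Rightarrow> nat \<Rightarrow> series" where
  "z_coeff F n = (\<lambda>(k, \<alpha>). if k = 0 then F (n, \<alpha>) else 0)"

text \<open>Writing \<open>F(z; x)\<close> as the sum of all \<open>F\<^sub>n(x) z\<^sup>n\<close>, the composition \<open>F(G(z; x); x)\<close> is the sum
  of all \<open>F\<^sub>n(x) G(z; x)\<^sup>n\<close>. When \<open>G\<close> has no constant term, every coefficient is a sum of finitely
  many nonzero terms. The univariate composition of power series over the ring of series in the
  variables \<open>x\<close> does not apply, because the part of \<open>G\<close> of degree \<open>0\<close> in \<open>z\<close> need not vanish.\<close>

definition z_compose :: "series \<Rightarrow> series \<Rightarrow> series" where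
  "z_compose F G e = Sum_any (\<lambda>n. series_mult (z_coeff F n) (series_power G n) e)"


section \<open>Young generating series\<close>

definition monomial_symmetric :: "nat multiset \<Rightarrow> (nat \<Rightarrow>\<^sub>0 nat) \<Rightarrow> rat" where
  "monomial_symmetric \<mu> \<alpha> =
     of_bool (image_mset (Poly_Mapping.lookup \<alpha>) (mset_set (Poly_Mapping.keys \<alpha>)) = \<mu>)"

text \<open>The dimension of \<open>P(m; \<mu>)\<close>, with the integer partition \<open>\<mu>\<close> given as the multiset of its
  parts. By functoriality it does not depend on the chosen pointed partition.\<close>

definition value_dim :: "'k ring \<Rightarrow> ('k, 'v) collection \<Rightarrow> nat \<Rightarrow> nat multiset \<Rightarrow> nat" where
  "value_dim K P m \<mu> = vectorspace.dim K (obj P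
     (SOME J. pointed_partition J \<and> card (marked J) = m \<and>
              image_mset card (mset_set (parts J)) = \<mu>))"

definition young_series :: "'k ring \<Rightarrow> ('k, 'v) collection \<Rightarrow> series" where
  "young_series K P = (\<lambda>(k, \<alpha>).
     of_bool (k = 1 \<and> \<alpha> = 0) +
     Sum_any (\<lambda>(n, \<mu>).
       if 0 \<notin># \<mu> \<and> n + sum_mset \<mu> \<ge> 2
       then of_nat (value_dim K P n \<mu>) * (of_bool (k = n) / fact n) *
            (monomial_symmetric \<mu> \<alpha> / (\<Prod>l\<in>#\<mu>. fact l))
       else 0))"

end

theory Submission
  imports Defs
begin

text \<open>
  A pointed partition of a set \<open>T\<close> is a colouring of \<open>T\<close> by the colours \<open>None\<close> (the marked part) and
  \<open>Some i\<close> (the \<open>i\<close>-th part), and the exponent \<open>(n, \<alpha>)\<close> counts the points of each colour. A series \<open>F\<close>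
  assigns to \<open>T\<close> its coefficient at the exponent of \<open>T\<close>, multiplied by the factorials that the Young
  series divides by. In these terms a product of series is a sum over the decompositions
  \<open>T = S \<union> (T - S)\<close>, so \<open>F\<^sup>n / n!\<close> is a sum over the partitions of \<open>T\<close> into \<open>n\<close> blocks, and a
  composition in \<open>z\<close> is a sum over the pairs of a set \<open>U\<close> of unmarked points (contributed by the
  variables \<open>x\<close> of the outer series) and a partition of \<open>T - U\<close>. As the inner series has no linear
  terms in \<open>x\<close>, the blocks of the latter can be taken not to be unmarked points; adding the singletons of \<open>U\<close>
  gives each partition of \<open>T\<close> exactly once, and its term is the dimension of the corresponding summand
  of the contraction product.
\<close>

section \<open>Dimensions of direct sums and tensor products\<close>

text \<open>The tensor products are concrete quotients of free spaces on all tuples of vectors, in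
  general infinite-dimensional, by the span of a set of relations. Their dimension is found from two
  sides: product functionals annihilate the relations and separate the tuples of basis vectors, and
  every submodule containing the relations and these tuples is the whole free space.

  The combinatorial obstacle is an unmarked point. Connectedness gives it dimension 1, but its
  coefficient in the Young series is 0. In the product over the blocks it must be left out rather
  than replaced by a coefficient, and the variables x of the outer series account for it instead.
  The coefficients at the empty set and at single points are prescribed, so these cases are compared
  separately. From two points on, a contraction is never a single unmarked point, so dimension and
  weight agree for the outer collection.\<close>

definition linear_functional :: "('k, 'a) ring_scheme \<Rightarrow> ('k, 'v, 'b) module_scheme \<Rightarrow> ('v \<Rightarrow> 'k) \<Rightarrow> bool" where
  "linear_functional K V l \<longleftrightarrow> l \<in> carrier V \<rightarrow> carrier K \<and>
     (\<forall>v\<in>carrier V. \<forall>w\<in>carrier V. l (v \<oplus>\<^bsub>V\<^esub> w) = l v \<oplus>\<^bsub>K\<^esub> l w) \<and>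
     (\<forall>c\<in>carrier K. \<forall>v\<in>carrier V. l (c \<odot>\<^bsub>V\<^esub> v) = c \<otimes>\<^bsub>K\<^esub> l v)"

text \<open>The last condition says that the family spans; the functionals witness its independence.\<close>

definition dual_basis ::
    "('k, 'a) ring_scheme \<Rightarrow> ('k, 'v, 'b) module_scheme \<Rightarrow> 'd set \<Rightarrow> ('d \<Rightarrow> 'v) \<Rightarrow> ('d \<Rightarrow> 'v \<Rightarrow> 'k) \<Rightarrow> bool" where
  "dual_basis K V D e l \<longleftrightarrow> finite D \<and>
     (\<forall>d\<in>D. e d \<in> carrier V \<and> linear_functional K V (l d)) \<and>
     (\<forall>d\<in>D. \<forall>d'\<in>D. l d (e d') = (if d = d' then \<one>\<^bsub>K\<^esub> else \<zero>\<^bsub>K\<^esub>)) \<and>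
     (\<forall>N. submodule K N V \<longrightarrow> e ` D \<subseteq> N \<longrightarrow> N = carrier V)"

lemma linear_functionalD:
  assumes "linear_functional K V l"
  shows "v \<in> carrier V \<Longrightarrow> l v \<in> carrier K"
    and "\<lbrakk>v \<in> carrier V; w \<in> carrier V\<rbrakk> \<Longrightarrow> l (v \<oplus>\<^bsub>V\<^esub> w) = l v \<oplus>\<^bsub>K\<^esub> l w"
    and "\<lbrakk>c \<in> carrier K; v \<in> carrier V\<rbrakk> \<Longrightarrow> l (c \<odot>\<^bsub>V\<^esub> v) = c \<otimes>\<^bsub>K\<^esub> l v"
  using assms by (auto simp: linear_functional_def)

section \<open>Dual bases and dimension\<close>

context vectorspace
begin

lemma linear_functional_zero:
  assumes "linear_functional K V l" shows "l \<zero>\<^bsub>V\<^esub> = \<zero>\<^bsub>K\<^esub>"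
proof -
  have "l (\<zero>\<^bsub>K\<^esub> \<odot>\<^bsub>V\<^esub> \<zero>\<^bsub>V\<^esub>) = \<zero>\<^bsub>K\<^esub> \<otimes>\<^bsub>K\<^esub> l \<zero>\<^bsub>V\<^esub>"
    by (intro linear_functionalD[OF assms]) auto
  then show ?thesis using linear_functionalD(1)[OF assms M.zero_closed] by simp
qed

lemma linear_functional_minus:
  assumes l: "linear_functional K V l" and v: "v \<in> carrier V" and w: "w \<in> carrier V"
  shows "l (v \<ominus>\<^bsub>V\<^esub> w) = l v \<ominus>\<^bsub>K\<^esub> l w"
proof -
  have "v \<ominus>\<^bsub>V\<^esub> w = v \<oplus>\<^bsub>V\<^esub> (\<ominus>\<^bsub>K\<^esub> \<one>\<^bsub>K\<^esub>) \<odot>\<^bsub>V\<^esub> w"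
    using w by (simp add: M.minus_eq smult_minus_1)
  also have "l \<dots> = l v \<oplus>\<^bsub>K\<^esub> (\<ominus>\<^bsub>K\<^esub> \<one>\<^bsub>K\<^esub>) \<otimes>\<^bsub>K\<^esub> l w"
    using v w by (simp add: linear_functionalD[OF l])
  also have "\<dots> = l v \<ominus>\<^bsub>K\<^esub> l w"
    using linear_functionalD(1)[OF l] v w by (simp add: R.minus_eq R.l_minus)
  finally show ?thesis .
qed

lemma linear_functional_kernel:
  assumes l: "linear_functional K V l"
  shows "submodule K {v \<in> carrier V. l v = \<zero>\<^bsub>K\<^esub>} V"
  using module_axioms
  by (auto simp: submodule_def linear_functionalD[OF l] linear_functional_zero[OF l])

text \<open>If a new vector lay in the span of the earlier ones, it would lie in the kernel of its
  own functional, which vanishes on all of them; but there its value is 1.\<close>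

lemma lin_indpt_of_functionals:
  assumes "finite B" "B \<subseteq> carrier V"
    and "\<And>b. b \<in> B \<Longrightarrow> \<exists>l. linear_functional K V l \<and> (\<forall>b'\<in>B. l b' = (if b = b' then \<one>\<^bsub>K\<^esub> else \<zero>\<^bsub>K\<^esub>))"
  shows "lin_indpt B"
  using assms
proof (induction B rule: finite_induct)
  case empty
  show ?case by (auto simp: lin_dep_def)
next
  case (insert b B)
  have li: "lin_indpt B"
  proof (rule insert.IH)
    fix x assume "x \<in> B"
    with insert.prems(2)[of x] show "\<exists>l. linear_functional K V l \<and> (\<forall>b'\<in>B. l b' = (if x = b' then \<one>\<^bsub>K\<^esub> else \<zero>\<^bsub>K\<^esub>))"
      by blast
  qed (use insert.prems in auto)
  show ?case
  proof
    assume "lin_dep (insert b B)"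
    then have sp: "b \<in> span B"
      using lin_dep_iff_in_span[of B b] li insert by simp
    obtain l where l: "linear_functional K V l" "\<forall>b'\<in>insert b B. l b' = (if b = b' then \<one>\<^bsub>K\<^esub> else \<zero>\<^bsub>K\<^esub>)"
      using insert.prems(2)[of b] by blast
    have "span B \<subseteq> {v \<in> carrier V. l v = \<zero>\<^bsub>K\<^esub>}"
      by (rule span_is_subset) (use insert l linear_functional_kernel in auto)
    with sp l show False by auto
  qed
qed

lemma dual_basis_dim:
  assumes d: "dual_basis K V D e l"
  shows "fin_dim" "dim = card D"
proof -
  have inj: "inj_on e D"
    using d by (auto simp: dual_basis_def inj_on_def split: if_splits) (metis one_not_zero)
  have fin: "finite (e ` D)" and sub: "e ` D \<subseteq> carrier V" using d by (auto simp: dual_basis_def)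
  have gen: "gen_set (e ` D)"
    using d span_is_submodule[OF sub] in_own_span[OF sub] by (auto simp: dual_basis_def)
  have li: "lin_indpt (e ` D)"
  proof (rule lin_indpt_of_functionals[OF fin sub])
    fix b assume "b \<in> e ` D"
    then obtain x where x: "x \<in> D" "b = e x" by auto
    with d inj show "\<exists>l. linear_functional K V l \<and> (\<forall>b'\<in>e ` D. l b' = (if b = b' then \<one>\<^bsub>K\<^esub> else \<zero>\<^bsub>K\<^esub>))"
      by (intro exI[of _ "l x"]) (auto simp: dual_basis_def inj_on_eq_iff)
  qed
  show fin_dim unfolding fin_dim_def using fin sub gen by blast
  have "basis (e ` D)" using gen li sub by (simp add: basis_def)
  then show "dim = card D" using dim_basis fin card_image[OF inj] by simp
qed

text \<open>The functionals are the coordinates with respect to a basis that is indexed by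
  itself.\<close>

lemma dual_basis_exists:
  assumes "fin_dim"
  obtains B l where "dual_basis K V B (\<lambda>b. b) l" "card B = dim"
proof -
  obtain B where B: "finite B" "basis B" using finite_basis_exists[OF assms] by blast
  have sub: "B \<subseteq> carrier V" and gen: "span B = carrier V" using B(2) by (auto simp: basis_def)
  define c where "c v = (THE a. a \<in> B \<rightarrow>\<^sub>E carrier K \<and> lincomb a B = v)" for v
  have ex1: "\<exists>!a. a \<in> B \<rightarrow>\<^sub>E carrier K \<and> lincomb a B = v" if "v \<in> carrier V" for v
    using basis_criterion[OF B(1) sub] B(2) that by blast
  have c: "c v \<in> B \<rightarrow>\<^sub>E carrier K" "lincomb (c v) B = v" if "v \<in> carrier V" for v
    using theI'[OF ex1[OF that]] by (auto simp: c_def)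
  \<comment> \<open>Uniqueness of coordinates reduces linearity and the values on the basis to
    exhibiting one linear combination each.\<close>
  have cI: "c v = restrict a B" if "a \<in> B \<rightarrow> carrier K" "lincomb a B = v" for a v
  proof -
    have v: "v \<in> carrier V" using that sub by auto
    have "lincomb (restrict a B) B = lincomb a B"
      by (rule lincomb_cong) (use that sub in auto)
    then show ?thesis
      using ex1[OF v] c[OF v] that by (metis restrict_PiE_iff Pi_iff)
  qed
  have lf: "linear_functional K V (\<lambda>v. c v b)" if b: "b \<in> B" for b
  proof -
    have add: "c (v \<oplus>\<^bsub>V\<^esub> w) = (\<lambda>b\<in>B. c v b \<oplus>\<^bsub>K\<^esub> c w b)" if "v \<in> carrier V" "w \<in> carrier V" for v w
    proof (rule cI)
      show "lincomb (\<lambda>b. c v b \<oplus>\<^bsub>K\<^esub> c w b) B = v \<oplus>\<^bsub>V\<^esub> w"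
        using lincomb_sum[OF B(1) sub, of "c v" "c w"] c[OF that(1)] c[OF that(2)] by (auto simp: PiE_def)
    qed (use c[OF that(1)] c[OF that(2)] in auto)
    have smu: "c (a \<odot>\<^bsub>V\<^esub> v) = (\<lambda>b\<in>B. a \<otimes>\<^bsub>K\<^esub> c v b)" if "v \<in> carrier V" "a \<in> carrier K" for v a
    proof (rule cI)
      show "lincomb (\<lambda>b. a \<otimes>\<^bsub>K\<^esub> c v b) B = a \<odot>\<^bsub>V\<^esub> v"
        using lincomb_smult[OF sub, of "c v" a] c[OF that(1)] that by (auto simp: PiE_def)
    qed (use c[OF that(1)] that in auto)
    show ?thesis unfolding linear_functional_def using b c by (auto simp: add smu)
  qed
  have del: "c b' b = (if b = b' then \<one>\<^bsub>K\<^esub> else \<zero>\<^bsub>K\<^esub>)" if "b \<in> B" "b' \<in> B" for b b'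
  proof -
    have "c b' = restrict (\<lambda>b. if b = b' then \<one>\<^bsub>K\<^esub> else \<zero>\<^bsub>K\<^esub>) B"
    proof (rule cI)
      have bc: "b' \<in> carrier V" using that sub by auto
      show "lincomb (\<lambda>b. if b = b' then \<one>\<^bsub>K\<^esub> else \<zero>\<^bsub>K\<^esub>) B = b'"
      proof -
        have "lincomb (\<lambda>b. if b = b' then \<one>\<^bsub>K\<^esub> else \<zero>\<^bsub>K\<^esub>) B = (\<Oplus>\<^bsub>V\<^esub>b\<in>B. if b' = b then b else \<zero>\<^bsub>V\<^esub>)"
          unfolding lincomb_def using sub by (intro M.finsum_cong') auto
        also have "\<dots> = b'"
          by (rule M.finsum_singleton) (use that sub B(1) in auto)
        finally show ?thesis .
      qed
    qed auto
    with that show ?thesis by auto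
  qed
  have "dual_basis K V B (\<lambda>b. b) (\<lambda>b v. c v b)"
    unfolding dual_basis_def
  proof (intro conjI ballI allI impI B(1) lf)
    fix N assume N: "submodule K N V" "(\<lambda>b. b) ` B \<subseteq> N"
    then show "N = carrier V"
      using span_is_subset[of B N] gen N(1) by (auto simp: submodule_def)
  qed (use sub del in auto)
  moreover have "card B = dim" using dim_basis[OF B] by simp
  ultimately show ?thesis using that by blast
qed

end

section \<open>Quotients by a submodule\<close>

lemma submodule_abelian_subgroup:
  assumes "vectorspace K M" "submodule K N M"
  shows "abelian_subgroup N M"
proof -
  interpret M: vectorspace K M by fact
  interpret N: submodule K N M by fact
  have "additive_subgroup N M"
  proof (rule additive_subgroup.intro, rule subgroup.intro)
    fix x assume "x \<in> N"
    have "\<ominus>\<^bsub>M\<^esub> x = (\<ominus>\<^bsub>K\<^esub> \<one>\<^bsub>K\<^esub>) \<odot>\<^bsub>M\<^esub> x"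
      using M.smult_minus_1 N.subset \<open>x \<in> N\<close> by auto
    then show "inv\<^bsub>add_monoid M\<^esub> x \<in> N"
      using \<open>x \<in> N\<close> by (simp add: a_inv_def)
  qed (use N.subset in auto)
  then show ?thesis
    by (rule abelian_subgroupI3) (rule M.abelian_group_axioms)
qed

text \<open>Scalar multiplication in the quotient is a union over all representatives of a coset.
  The cosets united in it are all equal, so it can be computed on one representative.\<close>

lemma quotient_space_operations:
  assumes "vectorspace K M" "submodule K N M"
  shows "carrier (quotient_space M N) = (\<lambda>a. N +>\<^bsub>M\<^esub> a) ` carrier M"
    and "\<lbrakk>a \<in> carrier M; b \<in> carrier M\<rbrakk> \<Longrightarrow>
      (N +>\<^bsub>M\<^esub> a) \<oplus>\<^bsub>quotient_space M N\<^esub> (N +>\<^bsub>M\<^esub> b) = N +>\<^bsub>M\<^esub> (a \<oplus>\<^bsub>M\<^esub> b)"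
    and "\<lbrakk>c \<in> carrier K; a \<in> carrier M\<rbrakk> \<Longrightarrow>
      c \<odot>\<^bsub>quotient_space M N\<^esub> (N +>\<^bsub>M\<^esub> a) = N +>\<^bsub>M\<^esub> (c \<odot>\<^bsub>M\<^esub> a)"
proof -
  interpret M: vectorspace K M by fact
  interpret N: submodule K N M by fact
  interpret N: abelian_subgroup N M by (rule submodule_abelian_subgroup) fact+
  show "carrier (quotient_space M N) = (\<lambda>a. N +>\<^bsub>M\<^esub> a) ` carrier M"
    by (auto simp: quotient_space_def A_RCOSETS_def')
  show "(N +>\<^bsub>M\<^esub> a) \<oplus>\<^bsub>quotient_space M N\<^esub> (N +>\<^bsub>M\<^esub> b) = N +>\<^bsub>M\<^esub> (a \<oplus>\<^bsub>M\<^esub> b)"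
    if "a \<in> carrier M" "b \<in> carrier M" for a b
    using that N.a_rcos_sum by (simp add: quotient_space_def)
  show "c \<odot>\<^bsub>quotient_space M N\<^esub> (N +>\<^bsub>M\<^esub> a) = N +>\<^bsub>M\<^esub> (c \<odot>\<^bsub>M\<^esub> a)"
    if "c \<in> carrier K" "a \<in> carrier M" for c a
  proof -
    have "N +>\<^bsub>M\<^esub> (c \<odot>\<^bsub>M\<^esub> b) = N +>\<^bsub>M\<^esub> (c \<odot>\<^bsub>M\<^esub> a)" if b: "b \<in> N +>\<^bsub>M\<^esub> a" for b
    proof -
      from b obtain n where n: "n \<in> N" "b = n \<oplus>\<^bsub>M\<^esub> a"
        by (auto simp: a_r_coset_def')
      then have "c \<odot>\<^bsub>M\<^esub> b = c \<odot>\<^bsub>M\<^esub> n \<oplus>\<^bsub>M\<^esub> c \<odot>\<^bsub>M\<^esub> a"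
        using \<open>a \<in> carrier M\<close> \<open>c \<in> carrier K\<close> N.subset by (auto simp: M.smult_r_distr)
      then have "c \<odot>\<^bsub>M\<^esub> b \<in> N +>\<^bsub>M\<^esub> (c \<odot>\<^bsub>M\<^esub> a)"
        using n \<open>c \<in> carrier K\<close> by (auto simp: a_r_coset_def')
      then show ?thesis
        using \<open>a \<in> carrier M\<close> \<open>c \<in> carrier K\<close> N.a_repr_independence' by auto
    qed
    moreover have "a \<in> N +>\<^bsub>M\<^esub> a" using \<open>a \<in> carrier M\<close> N.a_rcos_self by auto
    ultimately have "(\<Union>b\<in>N +>\<^bsub>M\<^esub> a. N +>\<^bsub>M\<^esub> (c \<odot>\<^bsub>M\<^esub> b)) = N +>\<^bsub>M\<^esub> (c \<odot>\<^bsub>M\<^esub> a)"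
      by (intro SUP_eq_const) blast+
    then show ?thesis by (simp add: quotient_space_def)
  qed
qed

text \<open>The functionals vanish on \<open>R\<close>, hence on its span, and descend to the
  quotient, where they are dual to the classes of the vectors \<open>e d\<close>. The condition
  \<open>gen\<close> is generation of the quotient, pulled back to \<open>M\<close>.\<close>

lemma quotient_space_dim:
  assumes M: "vectorspace K M" and R: "R \<subseteq> carrier M"
    and D: "finite D" and e: "\<And>d. d \<in> D \<Longrightarrow> e d \<in> carrier M"
    and l: "\<And>d. d \<in> D \<Longrightarrow> linear_functional K M (l d)"
    and lR: "\<And>d r. \<lbrakk>d \<in> D; r \<in> R\<rbrakk> \<Longrightarrow> l d r = \<zero>\<^bsub>K\<^esub>"
    and le: "\<And>d d'. \<lbrakk>d \<in> D; d' \<in> D\<rbrakk> \<Longrightarrow> l d (e d') = (if d = d' then \<one>\<^bsub>K\<^esub> else \<zero>\<^bsub>K\<^esub>)"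
    and gen: "\<And>N. \<lbrakk>submodule K N M; R \<subseteq> N; e ` D \<subseteq> N\<rbrakk> \<Longrightarrow> carrier M \<subseteq> N"
  shows "vectorspace.fin_dim K (quotient_space M (module.span K M R))"
    and "vectorspace.dim K (quotient_space M (module.span K M R)) = card D"
proof -
  interpret M: vectorspace K M by fact
  define N where "N = M.span R"
  have N: "submodule K N M" unfolding N_def by (rule M.span_is_submodule[OF R])
  interpret N: submodule K N M by (rule N)
  interpret N: abelian_subgroup N M by (rule submodule_abelian_subgroup) (rule M N)+
  interpret Q: vectorspace K "quotient_space M N" by (rule quotient_space_vectorspace[OF M N])
  note ops = quotient_space_operations[OF M N]
  have lN: "l d n = \<zero>\<^bsub>K\<^esub>" if "d \<in> D" "n \<in> N" for d n
    using M.span_is_subset[OF _ M.linear_functional_kernel[OF l[OF that(1)]], of R] that R lR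
    by (auto simp: N_def)
  \<comment> \<open>Any representative gives the same value, because \<open>l d\<close> vanishes on
    \<open>N\<close>.\<close>
  define q where "q d A = l d (SOME a. a \<in> A)" for d A
  have q: "q d (N +>\<^bsub>M\<^esub> a) = l d a" if d: "d \<in> D" and a: "a \<in> carrier M" for d a
  proof -
    have "(SOME b. b \<in> N +>\<^bsub>M\<^esub> a) \<in> N +>\<^bsub>M\<^esub> a"
      using N.a_rcos_self[OF a] by (rule someI)
    then obtain n where n: "n \<in> N" "(SOME b. b \<in> N +>\<^bsub>M\<^esub> a) = n \<oplus>\<^bsub>M\<^esub> a"
      by (auto simp: a_r_coset_def')
    then show ?thesis
      using lN[OF d n(1)] linear_functionalD(1,2)[OF l[OF d]] a N.subset by (auto simp: q_def)
  qed
  have "dual_basis K (quotient_space M N) D (\<lambda>d. N +>\<^bsub>M\<^esub> e d) q"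
    unfolding dual_basis_def
  proof (intro conjI ballI allI impI D)
    fix d assume d: "d \<in> D"
    show "N +>\<^bsub>M\<^esub> e d \<in> carrier (quotient_space M N)" using e[OF d] by (auto simp: ops(1))
    show "linear_functional K (quotient_space M N) (q d)"
      unfolding linear_functional_def
      by (auto simp: ops q[OF d] linear_functionalD[OF l[OF d]])
  next
    fix d d' assume "d \<in> D" "d' \<in> D"
    then show "q d (N +>\<^bsub>M\<^esub> e d') = (if d = d' then \<one>\<^bsub>K\<^esub> else \<zero>\<^bsub>K\<^esub>)"
      by (simp add: q e le)
  next
    fix N' assume N': "submodule K N' (quotient_space M N)" "(\<lambda>d. N +>\<^bsub>M\<^esub> e d) ` D \<subseteq> N'"
    interpret N': submodule K N' "quotient_space M N" by (rule N')
    \<comment> \<open>The preimage of \<open>N'\<close> contains the relations, because they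
      represent zero; so \<open>gen\<close> applies to it.\<close>
    let ?N = "{a \<in> carrier M. N +>\<^bsub>M\<^esub> a \<in> N'}"
    have z: "N +>\<^bsub>M\<^esub> n = \<zero>\<^bsub>quotient_space M N\<^esub>" if "n \<in> N" for n
      using that N.a_rcos_const[of n] by (simp add: quotient_space_def)
    have "submodule K ?N M"
    proof (rule submodule.intro[OF M.module_axioms], goal_cases)
      case (2 v w) then show ?case using N'.m_closed by (auto simp: ops(2)[symmetric])
    next
      case 3 then show ?case using z[OF N.zero_closed] N'.zero_closed by simp
    next
      case (4 c v) then show ?case using N'.smult_closed by (auto simp: ops(3)[symmetric])
    qed auto
    moreover have "R \<subseteq> ?N"
      using M.in_own_span[OF R] z R N'.zero_closed by (auto simp: N_def)
    moreover have "e ` D \<subseteq> ?N" using e N'(2) by auto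
    ultimately have "carrier M \<subseteq> ?N" by (rule gen)
    then show "N' = carrier (quotient_space M N)" using N'.subset by (auto simp: ops(1))
  qed
  from Q.dual_basis_dim[OF this]
  show "vectorspace.fin_dim K (quotient_space M (module.span K M R))"
    "vectorspace.dim K (quotient_space M (module.span K M R)) = card D"
    by (simp_all add: N_def)
qed

section \<open>Free spaces and linear extension from the generators\<close>

definition free_functional :: "'k ring \<Rightarrow> 'x set \<Rightarrow> ('x \<Rightarrow> 'k) \<Rightarrow> ('x \<Rightarrow> 'k) \<Rightarrow> 'k" where
  "free_functional K X h \<phi> = (\<Oplus>\<^bsub>K\<^esub>x\<in>{x \<in> X. \<phi> x \<noteq> \<zero>\<^bsub>K\<^esub>}. \<phi> x \<otimes>\<^bsub>K\<^esub> h x)"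

lemma free_space_simps:
  assumes "field K"
  shows "\<phi> \<in> carrier (free_space K X) \<longleftrightarrow> \<phi> \<in> X \<rightarrow>\<^sub>E carrier K \<and> finite {x \<in> X. \<phi> x \<noteq> \<zero>\<^bsub>K\<^esub>}"
    and "\<phi> \<oplus>\<^bsub>free_space K X\<^esub> \<psi> = (\<lambda>x\<in>X. \<phi> x \<oplus>\<^bsub>K\<^esub> \<psi> x)"
    and "c \<odot>\<^bsub>free_space K X\<^esub> \<phi> = (\<lambda>x\<in>X. c \<otimes>\<^bsub>K\<^esub> \<phi> x)"
    and "\<zero>\<^bsub>free_space K X\<^esub> = (\<lambda>x\<in>X. \<zero>\<^bsub>K\<^esub>)"
proof -
  interpret K: field K by fact
  show "\<phi> \<in> carrier (free_space K X) \<longleftrightarrow> \<phi> \<in> X \<rightarrow>\<^sub>E carrier K \<and> finite {x \<in> X. \<phi> x \<noteq> \<zero>\<^bsub>K\<^esub>}"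
    "\<phi> \<oplus>\<^bsub>free_space K X\<^esub> \<psi> = (\<lambda>x\<in>X. \<phi> x \<oplus>\<^bsub>K\<^esub> \<psi> x)"
    "c \<odot>\<^bsub>free_space K X\<^esub> \<phi> = (\<lambda>x\<in>X. c \<otimes>\<^bsub>K\<^esub> \<phi> x)"
    "\<zero>\<^bsub>free_space K X\<^esub> = (\<lambda>x\<in>X. \<zero>\<^bsub>K\<^esub>)"
    by (auto simp: free_space_def K.func_space_def)
qed

text \<open>The support changes under addition and scaling. Summing over any larger finite set
  allows linear extensions to be compared term by term.\<close>

lemma free_functional_eq:
  assumes K: "field K" and h: "h \<in> X \<rightarrow> carrier K" and p: "\<phi> \<in> X \<rightarrow> carrier K"
    and A: "finite A" "A \<subseteq> X" "{x \<in> X. \<phi> x \<noteq> \<zero>\<^bsub>K\<^esub>} \<subseteq> A"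
  shows "free_functional K X h \<phi> = (\<Oplus>\<^bsub>K\<^esub>x\<in>A. \<phi> x \<otimes>\<^bsub>K\<^esub> h x)"
proof -
  interpret K: field K by fact
  show ?thesis
    unfolding free_functional_def
    by (rule K.add.finprod_mono_neutral_cong_left) (use A h p in \<open>auto simp: Pi_def subset_iff\<close>)
qed

lemma linear_functional_free:
  assumes K: "field K" and h: "h \<in> X \<rightarrow> carrier K"
  shows "linear_functional K (free_space K X) (free_functional K X h)"
    and "x \<in> X \<Longrightarrow> free_functional K X h (free_gen K X x) = h x"
proof -
  interpret K: field K by fact
  interpret F: vectorspace K "free_space K X" by (rule free_space_vectorspace[OF K])
  let ?S = "\<lambda>\<phi>. {x \<in> X. \<phi> x \<noteq> \<zero>\<^bsub>K\<^esub>}"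
  note [simp] = free_space_simps[OF K]
  have h': "h x \<in> carrier K" if "x \<in> X" for x using h that by auto
  show "linear_functional K (free_space K X) (free_functional K X h)"
    unfolding linear_functional_def
  proof (intro conjI ballI funcsetI)
    fix \<phi> assume "\<phi> \<in> carrier (free_space K X)"
    then show "free_functional K X h \<phi> \<in> carrier K"
      by (auto simp: free_functional_def PiE_def intro!: K.finsum_closed h')
  next
    fix \<phi> \<psi> assume p: "\<phi> \<in> carrier (free_space K X)" "\<psi> \<in> carrier (free_space K X)"
    let ?A = "?S \<phi> \<union> ?S \<psi>"
    have ph: "\<phi> x \<in> carrier K" "\<psi> x \<in> carrier K" if "x \<in> X" for x using p that by auto
    have fin: "finite ?A" using p by auto
    have *: "free_functional K X h (\<phi> \<oplus>\<^bsub>free_space K X\<^esub> \<psi>) =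
        (\<Oplus>\<^bsub>K\<^esub>x\<in>?A. (\<phi> \<oplus>\<^bsub>free_space K X\<^esub> \<psi>) x \<otimes>\<^bsub>K\<^esub> h x)"
      by (rule free_functional_eq[OF K h _ fin]) (use ph in auto)
    also have "\<dots> = (\<Oplus>\<^bsub>K\<^esub>x\<in>?A. \<phi> x \<otimes>\<^bsub>K\<^esub> h x \<oplus>\<^bsub>K\<^esub> \<psi> x \<otimes>\<^bsub>K\<^esub> h x)"
      by (rule K.finsum_cong') (auto simp: K.l_distr ph h')
    also have "\<dots> = (\<Oplus>\<^bsub>K\<^esub>x\<in>?A. \<phi> x \<otimes>\<^bsub>K\<^esub> h x) \<oplus>\<^bsub>K\<^esub> (\<Oplus>\<^bsub>K\<^esub>x\<in>?A. \<psi> x \<otimes>\<^bsub>K\<^esub> h x)"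
      by (rule K.finsum_addf) (auto simp: ph h')
    also have "(\<Oplus>\<^bsub>K\<^esub>x\<in>?A. \<phi> x \<otimes>\<^bsub>K\<^esub> h x) = free_functional K X h \<phi>"
      by (rule free_functional_eq[OF K h _ fin, symmetric]) (use ph in auto)
    also have "(\<Oplus>\<^bsub>K\<^esub>x\<in>?A. \<psi> x \<otimes>\<^bsub>K\<^esub> h x) = free_functional K X h \<psi>"
      by (rule free_functional_eq[OF K h _ fin, symmetric]) (use ph in auto)
    finally show "free_functional K X h (\<phi> \<oplus>\<^bsub>free_space K X\<^esub> \<psi>) =
      free_functional K X h \<phi> \<oplus>\<^bsub>K\<^esub> free_functional K X h \<psi>" .
  next
    fix c \<phi> assume c: "c \<in> carrier K" and p: "\<phi> \<in> carrier (free_space K X)"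
    have ph: "\<phi> x \<in> carrier K" if "x \<in> X" for x using p that by auto
    have fin: "finite (?S \<phi>)" using p by auto
    have "free_functional K X h (c \<odot>\<^bsub>free_space K X\<^esub> \<phi>) =
        (\<Oplus>\<^bsub>K\<^esub>x\<in>?S \<phi>. (c \<odot>\<^bsub>free_space K X\<^esub> \<phi>) x \<otimes>\<^bsub>K\<^esub> h x)"
      by (rule free_functional_eq[OF K h _ fin]) (use ph c in auto)
    also have "\<dots> = (\<Oplus>\<^bsub>K\<^esub>x\<in>?S \<phi>. c \<otimes>\<^bsub>K\<^esub> (\<phi> x \<otimes>\<^bsub>K\<^esub> h x))"
      by (rule K.finsum_cong') (auto simp: K.m_assoc ph h' c)
    also have "\<dots> = c \<otimes>\<^bsub>K\<^esub> free_functional K X h \<phi>"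
      unfolding free_functional_def
      by (rule K.finsum_rdistr[symmetric]) (use fin c ph h' in auto)
    finally show "free_functional K X h (c \<odot>\<^bsub>free_space K X\<^esub> \<phi>) = c \<otimes>\<^bsub>K\<^esub> free_functional K X h \<phi>" .
  qed
  show "free_functional K X h (free_gen K X x) = h x" if x: "x \<in> X"
  proof -
    have "free_functional K X h (free_gen K X x) = (\<Oplus>\<^bsub>K\<^esub>y\<in>{x}. free_gen K X x y \<otimes>\<^bsub>K\<^esub> h y)"
      by (rule free_functional_eq[OF K h]) (use x in \<open>auto simp: free_gen_def\<close>)
    also have "\<dots> = h x" using x h' by (simp add: free_gen_def)
    finally show ?thesis .
  qed
qed

text \<open>Elements have finite support, so one generator at a time can be split off, by induction
  on a finite set that contains the support.\<close>

lemma free_space_generated: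
  assumes K: "field K" and N: "submodule K N (free_space K X)"
    and g: "\<And>x. x \<in> X \<Longrightarrow> free_gen K X x \<in> N"
  shows "carrier (free_space K X) \<subseteq> N"
proof
  interpret K: field K by fact
  interpret N: submodule K N "free_space K X" by fact
  note [simp] = free_space_simps[OF K]
  have "\<phi> \<in> N" if "finite A" "\<phi> \<in> X \<rightarrow>\<^sub>E carrier K" "{x \<in> X. \<phi> x \<noteq> \<zero>\<^bsub>K\<^esub>} \<subseteq> A" for A \<phi>
    using that
  proof (induction A arbitrary: \<phi> rule: finite_induct)
    case empty
    then have "\<phi> = \<zero>\<^bsub>free_space K X\<^esub>" by (auto simp: fun_eq_iff PiE_def extensional_def)
    then show ?case using N.zero_closed by (simp only:)
  next
    case (insert a A)
    show ?case
    \<comment> \<open>A point outside \<open>X\<close> is not in the support and is merely dropped: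
      changing the function there would destroy its extensionality.\<close>
    proof (cases "a \<in> X")
      case False
      then show ?thesis using insert by (intro insert.IH) auto
    next
      case True
      let ?r = "\<phi>(a := \<zero>\<^bsub>K\<^esub>)"
      have ph: "\<phi> x \<in> carrier K" if "x \<in> X" for x using insert.prems that by auto
      have "?r \<in> N"
        using insert True by (intro insert.IH) (auto simp: PiE_def extensional_def)
      moreover have "\<phi> = ?r \<oplus>\<^bsub>free_space K X\<^esub> \<phi> a \<odot>\<^bsub>free_space K X\<^esub> free_gen K X a"
        using insert.prems(1) True by (auto simp: fun_eq_iff PiE_def extensional_def free_gen_def ph)
      ultimately show ?thesis
        using g[OF True] ph[OF True] by (metis N.m_closed N.smult_closed)
    qed
  qed
  then show "\<phi> \<in> N" if "\<phi> \<in> carrier (free_space K X)" for \<phi> using that by auto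
qed

section \<open>Tensor products of two spaces and of finite families\<close>

lemma submodule_minus_mem:
  assumes "vectorspace K M" "submodule K N M"
    and "a \<in> carrier M" "b \<in> N" "a \<ominus>\<^bsub>M\<^esub> b \<in> N"
  shows "a \<in> N"
proof -
  interpret M: vectorspace K M by fact
  interpret N: submodule K N M by fact
  have b: "b \<in> carrier M" using assms(4) N.subset by auto
  have "a = (a \<ominus>\<^bsub>M\<^esub> b) \<oplus>\<^bsub>M\<^esub> b"
    using assms(3) b by (simp add: M.M.minus_eq M.M.a_assoc M.M.l_neg)
  then show ?thesis using assms(4,5) N.m_closed by metis
qed

lemma tensor_dim:
  assumes V: "vectorspace K V" and W: "vectorspace K W"
    and fV: "vectorspace.fin_dim K V" and fW: "vectorspace.fin_dim K W"
  shows "vectorspace.fin_dim K (tensor K V W)"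
    and "vectorspace.dim K (tensor K V W) = vectorspace.dim K V * vectorspace.dim K W"
proof -
  interpret V: vectorspace K V by fact
  interpret W: vectorspace K W by fact
  have K: "field K" by (rule V.field_axioms)
  let ?F = "free_space K (pairs V W)" and ?\<delta> = "free_gen K (pairs V W)"
  interpret F: vectorspace K ?F by (rule free_space_vectorspace[OF K])
  obtain B lb where B: "dual_basis K V B (\<lambda>b. b) lb" "card B = V.dim" by (rule V.dual_basis_exists[OF fV])
  obtain C lc where C: "dual_basis K W C (\<lambda>c. c) lc" "card C = W.dim" by (rule W.dual_basis_exists[OF fW])
  have fin: "finite (B \<times> C)" using B C by (simp add: dual_basis_def)
  have Bc: "B \<subseteq> carrier V" and Cc: "C \<subseteq> carrier W" using B C by (auto simp: dual_basis_def)
  have lb: "linear_functional K V (lb b)" if "b \<in> B" for b using B that by (simp add: dual_basis_def)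
  have lc: "linear_functional K W (lc c)" if "c \<in> C" for c using C that by (simp add: dual_basis_def)
  \<comment> \<open>The product of two coordinate functionals is bilinear, so its linear extension
    to the free space vanishes on the relations.\<close>
  define h where "h = (\<lambda>(b, c) (v, w). lb b v \<otimes>\<^bsub>K\<^esub> lc c w)"
  have h: "h d \<in> pairs V W \<rightarrow> carrier K" if "d \<in> B \<times> C" for d
    using that by (auto simp: h_def pairs_def linear_functionalD(1)[OF lb] linear_functionalD(1)[OF lc])
  have \<delta>: "?\<delta> (v, w) \<in> carrier ?F" if "v \<in> carrier V" "w \<in> carrier W" for v w
    by (rule free_gen_in_carrier[OF K]) (use that in \<open>simp add: pairs_def\<close>)
  let ?R = "bilinear_relations K V W"
  let ?l = "\<lambda>d. free_functional K (pairs V W) (h d)"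
  have l: "linear_functional K ?F (?l d)" if "d \<in> B \<times> C" for d
    by (rule linear_functional_free[OF K h[OF that]])
  have lg: "?l d (?\<delta> (v, w)) = h d (v, w)" if "d \<in> B \<times> C" "v \<in> carrier V" "w \<in> carrier W" for d v w
    by (rule linear_functional_free(2)[OF K h[OF that(1)]]) (use that in \<open>simp add: pairs_def\<close>)
  have lR: "?l d r = \<zero>\<^bsub>K\<^esub>" if d: "d \<in> B \<times> C" and r: "r \<in> ?R" for d r
  proof -
    obtain b c where bc: "d = (b, c)" "b \<in> B" "c \<in> C" using d by auto
    note lin = linear_functionalD[OF lb[OF bc(2)]] linear_functionalD[OF lc[OF bc(3)]]
    have diff: "\<And>x. x \<in> carrier K \<Longrightarrow> x \<ominus>\<^bsub>K\<^esub> x = \<zero>\<^bsub>K\<^esub>"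
      by (simp add: V.R.minus_eq V.R.r_neg)
    note s = F.linear_functional_minus[OF l[OF d]] linear_functionalD(2,3)[OF l[OF d]] lg[OF d] \<delta>
    from r show ?thesis
      unfolding bilinear_relations_def Let_def
      by (auto simp: s)
         (auto simp: h_def bc lin diff V.R.l_distr V.R.r_distr V.R.m_assoc V.R.m_lcomm)
  qed
  have le: "?l d (?\<delta> d') = (if d = d' then \<one>\<^bsub>K\<^esub> else \<zero>\<^bsub>K\<^esub>)" if d: "d \<in> B \<times> C" "d' \<in> B \<times> C" for d d'
  proof -
    obtain b c b' c' where bc: "d = (b, c)" "b \<in> B" "c \<in> C" "d' = (b', c')" "b' \<in> B" "c' \<in> C"
      using d by auto
    have "?l d (?\<delta> d') = lb b b' \<otimes>\<^bsub>K\<^esub> lc c c'"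
      unfolding bc(4) by (subst lg[OF d(1)]) (use bc Bc Cc in \<open>auto simp: h_def\<close>)
    also have "\<dots> = (if d = d' then \<one>\<^bsub>K\<^esub> else \<zero>\<^bsub>K\<^esub>)"
      using B(1) C(1) bc by (auto simp: dual_basis_def)
    finally show ?thesis .
  qed
  have gen: "carrier ?F \<subseteq> N" if N: "submodule K N ?F" "?R \<subseteq> N" "?\<delta> ` (B \<times> C) \<subseteq> N" for N
  proof (rule free_space_generated[OF K N(1)])
    interpret N: submodule K N ?F by (rule N)
    \<comment> \<open>Every relation is a difference a - b, so a lies in \<open>N\<close> as soon as
      b does. This turns the relations into closure rules.\<close>
    note mem = submodule_minus_mem[OF F.vectorspace_axioms N(1)]
    have addl: "?\<delta> (v \<oplus>\<^bsub>V\<^esub> v', w) \<in> N"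
      if "v \<in> carrier V" "v' \<in> carrier V" "w \<in> carrier W" "?\<delta> (v, w) \<in> N" "?\<delta> (v', w) \<in> N" for v v' w
      by (rule mem[OF _ N.m_closed[OF that(4,5)]])
         (use that \<delta> in simp, rule subsetD[OF N(2)],
          use that in \<open>unfold bilinear_relations_def Let_def, blast\<close>)
    have addr: "?\<delta> (v, w \<oplus>\<^bsub>W\<^esub> w') \<in> N"
      if "v \<in> carrier V" "w \<in> carrier W" "w' \<in> carrier W" "?\<delta> (v, w) \<in> N" "?\<delta> (v, w') \<in> N" for v w w'
      by (rule mem[OF _ N.m_closed[OF that(4,5)]])
         (use that \<delta> in simp, rule subsetD[OF N(2)],
          use that in \<open>unfold bilinear_relations_def Let_def, blast\<close>)
    have smul: "?\<delta> (c \<odot>\<^bsub>V\<^esub> v, w) \<in> N" if "c \<in> carrier K" "v \<in> carrier V" "w \<in> carrier W"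
      "c \<odot>\<^bsub>?F\<^esub> ?\<delta> (v, w) \<in> N" for c v w
      by (rule mem[OF _ that(4)])
         (use that \<delta> in simp, rule subsetD[OF N(2)],
          use that in \<open>unfold bilinear_relations_def Let_def, blast\<close>)
    have smur: "?\<delta> (v, c \<odot>\<^bsub>W\<^esub> w) \<in> N" if "c \<in> carrier K" "v \<in> carrier V" "w \<in> carrier W"
      "c \<odot>\<^bsub>?F\<^esub> ?\<delta> (v, w) \<in> N" for c v w
      by (rule mem[OF _ that(4)])
         (use that \<delta> in simp, rule subsetD[OF N(2)],
          use that in \<open>unfold bilinear_relations_def Let_def, blast\<close>)
    \<comment> \<open>The generator at a pair with a zero entry is a nonzero element of the free
      space. The scaling relation with scalar 0 compares it with the zero vector, which lies in
      \<open>N\<close>.\<close>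
    have z0: "\<zero>\<^bsub>K\<^esub> \<odot>\<^bsub>?F\<^esub> ?\<delta> (v, w) \<in> N" if "v \<in> carrier V" "w \<in> carrier W" for v w
      using \<delta>[OF that] N.zero_closed by simp
    have zl: "?\<delta> (\<zero>\<^bsub>V\<^esub>, w) \<in> N" if "w \<in> carrier W" for w
      using smul[of "\<zero>\<^bsub>K\<^esub>" "\<zero>\<^bsub>V\<^esub>" w] z0[of "\<zero>\<^bsub>V\<^esub>" w] that by simp
    have zr: "?\<delta> (v, \<zero>\<^bsub>W\<^esub>) \<in> N" if "v \<in> carrier V" for v
      using smur[of "\<zero>\<^bsub>K\<^esub>" v "\<zero>\<^bsub>W\<^esub>"] z0[of v "\<zero>\<^bsub>W\<^esub>"] that by simp
    \<comment> \<open>The arguments are freed one at a time: here the first is arbitrary and the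
      second still a basis vector.\<close>
    have left: "?\<delta> (v, c) \<in> N" if c: "c \<in> C" and v: "v \<in> carrier V" for v c
    proof -
      have cW: "c \<in> carrier W" using c Cc by auto
      have "submodule K {v \<in> carrier V. ?\<delta> (v, c) \<in> N} V"
        by (rule submodule.intro[OF V.module_axioms]) (use cW in \<open>auto intro: addl smul zl\<close>)
      moreover have "(\<lambda>b. b) ` B \<subseteq> {v \<in> carrier V. ?\<delta> (v, c) \<in> N}" using N(3) c Bc by auto
      ultimately have "{v \<in> carrier V. ?\<delta> (v, c) \<in> N} = carrier V"
        using B(1) unfolding dual_basis_def by blast
      with v show ?thesis by blast
    qed
    fix x assume "x \<in> pairs V W"
    then obtain v w where x: "x = (v, w)" "v \<in> carrier V" "w \<in> carrier W" by (auto simp: pairs_def)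
    have "submodule K {w \<in> carrier W. ?\<delta> (v, w) \<in> N} W"
      by (rule submodule.intro[OF W.module_axioms]) (use x in \<open>auto intro: addr smur zr\<close>)
    moreover have "(\<lambda>c. c) ` C \<subseteq> {w \<in> carrier W. ?\<delta> (v, w) \<in> N}" using left x Cc by auto
    ultimately have "{w \<in> carrier W. ?\<delta> (v, w) \<in> N} = carrier W"
      using C(1) unfolding dual_basis_def by blast
    with x show "?\<delta> x \<in> N" by blast
  qed
  have Rc: "?R \<subseteq> carrier ?F" by (rule bilinear_relations_subset[OF V W])
  have "vectorspace.fin_dim K (quotient_space ?F (module.span K ?F ?R))"
    by (rule quotient_space_dim(1)[OF F.vectorspace_axioms _ fin _ l lR le gen])
       (use Rc Bc Cc in \<open>auto intro!: \<delta>\<close>)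
  then show "vectorspace.fin_dim K (tensor K V W)"
    by (simp add: tensor_def bilinear_kernel_def)
  have "vectorspace.dim K (quotient_space ?F (module.span K ?F ?R)) = card (B \<times> C)"
    by (rule quotient_space_dim(2)[OF F.vectorspace_axioms _ fin _ l lR le gen])
       (use Rc Bc Cc in \<open>auto intro!: \<delta>\<close>)
  then show "vectorspace.dim K (tensor K V W) = vectorspace.dim K V * vectorspace.dim K W"
    by (simp add: tensor_def bilinear_kernel_def card_cartesian_product B C)
qed

lemma tensor_family_dim:
  assumes K: "field K" and S: "finite S"
    and V: "\<And>i. i \<in> S \<Longrightarrow> vectorspace K (V i)" and fV: "\<And>i. i \<in> S \<Longrightarrow> vectorspace.fin_dim K (V i)"
  shows "vectorspace.fin_dim K (tensor_family K S V)"
    and "vectorspace.dim K (tensor_family K S V) = (\<Prod>i\<in>S. vectorspace.dim K (V i))"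
proof -
  interpret K: field K by fact
  let ?X = "tuples S V"
  let ?F = "free_space K ?X" and ?\<delta> = "free_gen K ?X"
  interpret F: vectorspace K ?F by (rule free_space_vectorspace[OF K])
  have "\<exists>B l. dual_basis K (V i) B (\<lambda>b. b) l \<and> card B = vectorspace.dim K (V i)" if "i \<in> S" for i
    using vectorspace.dual_basis_exists[OF V[OF that] fV[OF that]] by metis
  then obtain B l where B: "\<And>i. i \<in> S \<Longrightarrow> dual_basis K (V i) (B i) (\<lambda>b. b) (l i)"
    "\<And>i. i \<in> S \<Longrightarrow> card (B i) = vectorspace.dim K (V i)" by metis
  let ?D = "\<Pi>\<^sub>E i\<in>S. B i"
  have fin: "finite ?D" using B(1) S by (intro finite_PiE) (auto simp: dual_basis_def)
  have Bc: "B i \<subseteq> carrier (V i)" if "i \<in> S" for i using B(1)[OF that] by (auto simp: dual_basis_def)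
  have lf: "linear_functional K (V i) (l i b)" if "i \<in> S" "b \<in> B i" for i b
    using B(1)[OF that(1)] that by (simp add: dual_basis_def)
  define h where "h d x = (\<Otimes>\<^bsub>K\<^esub>i\<in>S. l i (d i) (x i))" for d x
  have lc: "l i (d i) (x i) \<in> carrier K" if "d \<in> ?D" "x \<in> ?X" "i \<in> S" for d x i
    by (rule linear_functionalD(1)[OF lf]) (use that in \<open>auto simp: tuples_def\<close>)
  have h: "h d \<in> ?X \<rightarrow> carrier K" if "d \<in> ?D" for d
    using lc[OF that] by (auto simp: h_def intro!: K.finprod_closed)
  have upd: "x(i := v) \<in> ?X" if "x \<in> ?X" "i \<in> S" "v \<in> carrier (V i)" for x i v
    using that by (auto simp: tuples_def PiE_def extensional_def)
  have \<delta>: "?\<delta> x \<in> carrier ?F" if "x \<in> ?X" for x by (rule free_gen_in_carrier[OF K that])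
  \<comment> \<open>With all entries but one fixed, \<open>h d\<close> is a scalar multiple of
    \<open>l i (d i)\<close>. This is the multilinearity that annihilates the relations.\<close>
  have hup: "h d (x(i := v)) = l i (d i) v \<otimes>\<^bsub>K\<^esub> (\<Otimes>\<^bsub>K\<^esub>j\<in>S - {i}. l j (d j) (x j))"
    if "d \<in> ?D" "x \<in> ?X" "i \<in> S" "v \<in> carrier (V i)" for d x i v
  proof -
    have "h d (x(i := v)) = (\<Otimes>\<^bsub>K\<^esub>j\<in>insert i (S - {i}). l j (d j) ((x(i := v)) j))"
      using that(3) by (simp add: h_def insert_absorb)
    also have "\<dots> = l i (d i) ((x(i := v)) i) \<otimes>\<^bsub>K\<^esub> (\<Otimes>\<^bsub>K\<^esub>j\<in>S - {i}. l j (d j) ((x(i := v)) j))"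
      by (rule K.finprod_insert) (use S lc[OF that(1) upd[OF that(2-4)]] that(3) in \<open>auto split: if_splits simp del: fun_upd_apply\<close>)
    also have "(\<Otimes>\<^bsub>K\<^esub>j\<in>S - {i}. l j (d j) ((x(i := v)) j)) = (\<Otimes>\<^bsub>K\<^esub>j\<in>S - {i}. l j (d j) (x j))"
      by (rule K.finprod_cong') (use lc[OF that(1,2)] in auto)
    finally show ?thesis by (simp only: fun_upd_same)
  qed
  have rest: "(\<Otimes>\<^bsub>K\<^esub>j\<in>S - {i}. l j (d j) (x j)) \<in> carrier K" if "d \<in> ?D" "x \<in> ?X" for d x i
    by (rule K.finprod_closed) (use lc[OF that] in auto)
  let ?R = "multilinear_relations K S V"
  let ?l = "\<lambda>d. free_functional K ?X (h d)"
  have l: "linear_functional K ?F (?l d)" if "d \<in> ?D" for d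
    by (rule linear_functional_free[OF K h[OF that]])
  have lg: "?l d (?\<delta> x) = h d x" if "d \<in> ?D" "x \<in> ?X" for d x
    by (rule linear_functional_free(2)[OF K h[OF that(1)] that(2)])
  have Vadd: "v \<oplus>\<^bsub>V i\<^esub> w \<in> carrier (V i)" if "i \<in> S" "v \<in> carrier (V i)" "w \<in> carrier (V i)" for i v w
  proof -
    interpret V: vectorspace K "V i" by (rule V[OF that(1)])
    show ?thesis using that by simp
  qed
  have Vsm: "c \<odot>\<^bsub>V i\<^esub> v \<in> carrier (V i)" if "i \<in> S" "v \<in> carrier (V i)" "c \<in> carrier K" for i v c
  proof -
    interpret V: vectorspace K "V i" by (rule V[OF that(1)])
    show ?thesis using that by simp
  qed
  have lR: "?l d r = \<zero>\<^bsub>K\<^esub>" if d: "d \<in> ?D" and r: "r \<in> ?R" for d r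
  proof -
    have diff: "\<And>x. x \<in> carrier K \<Longrightarrow> x \<ominus>\<^bsub>K\<^esub> x = \<zero>\<^bsub>K\<^esub>"
      by (simp add: K.minus_eq K.r_neg)
    have di: "d i \<in> B i" if "i \<in> S" for i using d that by auto
    note lin = linear_functionalD[OF lf[OF _ di]]
    note s = F.linear_functional_minus[OF l[OF d]] linear_functionalD(2,3)[OF l[OF d]] lg[OF d] \<delta>
    from r show ?thesis
      unfolding multilinear_relations_def Let_def
      by (auto simp: s upd Vadd Vsm hup[OF d])
         (auto simp: lin diff rest[OF d] K.l_distr K.m_assoc)
  qed
  have Dt: "d \<in> ?X" if "d \<in> ?D" for d using that Bc by (auto simp: tuples_def PiE_def Pi_def)
  have le: "?l d (?\<delta> d') = (if d = d' then \<one>\<^bsub>K\<^esub> else \<zero>\<^bsub>K\<^esub>)" if d: "d \<in> ?D" "d' \<in> ?D" for d d'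
  proof -
    have val: "l i (d i) (d' i) = (if d i = d' i then \<one>\<^bsub>K\<^esub> else \<zero>\<^bsub>K\<^esub>)" if "i \<in> S" for i
      using B(1)[OF that] PiE_mem[OF d(1) that] PiE_mem[OF d(2) that] by (simp add: dual_basis_def)
    show ?thesis
    proof (cases "d = d'")
      case True
      have "h d d' = \<one>\<^bsub>K\<^esub>" unfolding h_def by (rule K.finprod_one_eqI) (use val True in auto)
      then show ?thesis using True lg[OF d(1) Dt[OF d(2)]] by simp
    next
      case False
      then obtain i where i: "i \<in> S" "d i \<noteq> d' i" using d by (metis PiE_ext)
      \<comment> \<open>Writing \<open>d'\<close> as an update of itself at \<open>i\<close> lets
        \<open>hup\<close> split off the factor at \<open>i\<close>, which is zero.\<close>
      have "h d (d'(i := d' i)) = l i (d i) (d' i) \<otimes>\<^bsub>K\<^esub> (\<Otimes>\<^bsub>K\<^esub>j\<in>S - {i}. l j (d j) (d' j))"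
        by (rule hup) (use d i Dt subsetD[OF Bc[OF i(1)] PiE_mem[OF d(2) i(1)]] in auto)
      then show ?thesis using False lg[OF d(1) Dt[OF d(2)]] val[OF i(1)] i rest[OF d(1) Dt[OF d(2)]] by simp
    qed
  qed
  have gen: "carrier ?F \<subseteq> N" if N: "submodule K N ?F" "?R \<subseteq> N" "?\<delta> ` ?D \<subseteq> N" for N
  proof (rule free_space_generated[OF K N(1)])
    interpret N: submodule K N ?F by (rule N)
    note mem = submodule_minus_mem[OF F.vectorspace_axioms N(1)]
    have add: "?\<delta> (x(i := v \<oplus>\<^bsub>V i\<^esub> w)) \<in> N"
      if "x \<in> ?X" "i \<in> S" "v \<in> carrier (V i)" "w \<in> carrier (V i)" "?\<delta> (x(i := v)) \<in> N" "?\<delta> (x(i := w)) \<in> N" for x i v w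
      by (rule mem[OF _ N.m_closed[OF that(5,6)]])
         (use that \<delta> upd Vadd in simp, rule subsetD[OF N(2)],
          use that in \<open>unfold multilinear_relations_def Let_def, blast\<close>)
    have smu: "?\<delta> (x(i := c \<odot>\<^bsub>V i\<^esub> v)) \<in> N"
      if "x \<in> ?X" "i \<in> S" "v \<in> carrier (V i)" "c \<in> carrier K" "c \<odot>\<^bsub>?F\<^esub> ?\<delta> (x(i := v)) \<in> N" for x i v c
      by (rule mem[OF _ that(5)])
         (use that \<delta> upd Vsm in simp, rule subsetD[OF N(2)],
          use that in \<open>unfold multilinear_relations_def Let_def, blast\<close>)
    \<comment> \<open>\<open>A\<close> is the set of positions that may hold arbitrary vectors. The
      induction starts from tuples of basis vectors and frees one position at a time.\<close>
    have "?\<delta> x \<in> N" if "finite A" "A \<subseteq> S" "x \<in> ?X" "\<forall>i\<in>S - A. x i \<in> B i" for A x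
      using that
    proof (induction A arbitrary: x rule: finite_induct)
      case empty
      then have "x \<in> ?D" by (auto simp: tuples_def PiE_def)
      then show ?case using N(3) by auto
    next
      case (insert a A)
      have a: "a \<in> S" using insert.prems by auto
      interpret V: vectorspace K "V a" by (rule V[OF a])
      let ?U = "{v \<in> carrier (V a). ?\<delta> (x(a := v)) \<in> N}"
      have z: "?\<delta> (x(a := \<zero>\<^bsub>V a\<^esub>)) \<in> N"
      proof -
        have "\<zero>\<^bsub>K\<^esub> \<odot>\<^bsub>?F\<^esub> ?\<delta> (x(a := \<zero>\<^bsub>V a\<^esub>)) \<in> N"
          using \<delta>[OF upd[OF insert.prems(2) a]] N.zero_closed by simp
        then show ?thesis using smu[OF insert.prems(2) a, of "\<zero>\<^bsub>V a\<^esub>" "\<zero>\<^bsub>K\<^esub>"] by simp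
      qed
      have "submodule K ?U (V a)"
        by (rule submodule.intro[OF V.module_axioms]) (use insert.prems(2) a in \<open>auto intro: add smu z\<close>)
      moreover have "(\<lambda>b. b) ` B a \<subseteq> ?U"
      proof clarsimp
        fix b assume b: "b \<in> B a"
        have "?\<delta> (x(a := b)) \<in> N"
          by (rule insert.IH[OF _ upd[OF insert.prems(2) a subsetD[OF Bc[OF a] b]]]) (use insert.prems b in auto)
        then show "b \<in> carrier (V a) \<and> ?\<delta> (x(a := b)) \<in> N" using b Bc[OF a] by auto
      qed
      ultimately have U: "?U = carrier (V a)" using B(1)[OF a] unfolding dual_basis_def by blast
      have "x a \<in> carrier (V a)" using insert.prems(2) a by (auto simp: tuples_def)
      then have "?\<delta> (x(a := x a)) \<in> N" using U by blast
      then show ?case by simp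
    qed
    then show "?\<delta> x \<in> N" if "x \<in> ?X" for x using S that by blast
  qed
  have Rc: "?R \<subseteq> carrier ?F" by (rule multilinear_relations_subset[OF K V])
  have "vectorspace.fin_dim K (quotient_space ?F (module.span K ?F ?R))"
    by (rule quotient_space_dim(1)[OF F.vectorspace_axioms _ fin _ l lR le gen])
       (use Rc \<delta> Dt in auto)
  then show "vectorspace.fin_dim K (tensor_family K S V)"
    by (simp add: tensor_family_def multilinear_kernel_def)
  have "vectorspace.dim K (quotient_space ?F (module.span K ?F ?R)) = card ?D"
    by (rule quotient_space_dim(2)[OF F.vectorspace_axioms _ fin _ l lR le gen])
       (use Rc \<delta> Dt in auto)
  then show "vectorspace.dim K (tensor_family K S V) = (\<Prod>i\<in>S. vectorspace.dim K (V i))"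
    by (simp add: tensor_family_def multilinear_kernel_def card_PiE[OF S] B(2))
qed

text \<open>The embedded bases of the summands are dual to the functionals that first project to a
  summand and then take a coordinate.\<close>

lemma finite_direct_sum_dim:
  assumes K: "field K" and S: "finite S"
    and V: "\<And>i. i \<in> S \<Longrightarrow> vectorspace K (V i)" and fV: "\<And>i. i \<in> S \<Longrightarrow> vectorspace.fin_dim K (V i)"
  shows "vectorspace.dim K (finite_direct_sum S V) = (\<Sum>i\<in>S. vectorspace.dim K (V i))"
proof -
  interpret K: field K by fact
  let ?M = "finite_direct_sum S V"
  interpret M: vectorspace K ?M by (rule finite_direct_sum_vectorspace[OF K V])
  have "\<exists>B l. dual_basis K (V i) B (\<lambda>b. b) l \<and> card B = vectorspace.dim K (V i)" if "i \<in> S" for i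
    using vectorspace.dual_basis_exists[OF V[OF that] fV[OF that]] by metis
  then obtain B l where B: "\<And>i. i \<in> S \<Longrightarrow> dual_basis K (V i) (B i) (\<lambda>b. b) (l i)"
    "\<And>i. i \<in> S \<Longrightarrow> card (B i) = vectorspace.dim K (V i)" by metis
  have Bc: "B i \<subseteq> carrier (V i)" and Bf: "finite (B i)" if "i \<in> S" for i
    using B(1)[OF that] by (auto simp: dual_basis_def)
  have lf: "linear_functional K (V i) (l i b)" if "i \<in> S" "b \<in> B i" for i b
    using B(1)[OF that(1)] that by (simp add: dual_basis_def)
  have zc: "\<zero>\<^bsub>V i\<^esub> \<in> carrier (V i)" if "i \<in> S" for i
  proof -
    interpret V: vectorspace K "V i" by (rule V[OF that])
    show ?thesis by simp
  qed
  have lz: "l i b \<zero>\<^bsub>V i\<^esub> = \<zero>\<^bsub>K\<^esub>" if "i \<in> S" "b \<in> B i" for i b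
    by (rule vectorspace.linear_functional_zero[OF V lf]) (use that in auto)
  define emb where "emb i v = (\<lambda>j\<in>S. if j = i then v else \<zero>\<^bsub>V j\<^esub>)" for i v
  have emb: "emb i v \<in> carrier ?M" if "i \<in> S" "v \<in> carrier (V i)" for i v
    using that zc by (auto simp: emb_def finite_direct_sum_def)
  have "dual_basis K ?M (Sigma S B) (\<lambda>(i, b). emb i b) (\<lambda>(i, b) v. l i b (v i))"
    unfolding dual_basis_def
  proof (intro conjI ballI allI impI)
    show "finite (Sigma S B)" using S Bf by auto
  next
    fix d assume "d \<in> Sigma S B"
    then obtain i b where d: "d = (i, b)" "i \<in> S" "b \<in> B i" by auto
    show "(case d of (i, b) \<Rightarrow> emb i b) \<in> carrier ?M" using d Bc emb by auto
    have vi: "v i \<in> carrier (V i)" if "v \<in> (\<Pi>\<^sub>E i\<in>S. carrier (V i))" for v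
      using that d(2) by auto
    show "linear_functional K ?M (case d of (i, b) \<Rightarrow> \<lambda>v. l i b (v i))"
      using d(2) by (auto simp: d(1) linear_functional_def finite_direct_sum_def vi
        linear_functionalD[OF lf[OF d(2,3)]])
  next
    fix d d' assume "d \<in> Sigma S B" "d' \<in> Sigma S B"
    then obtain i b i' b' where d: "d = (i, b)" "i \<in> S" "b \<in> B i" "d' = (i', b')" "i' \<in> S" "b' \<in> B i'"
      by auto
    show "(case d of (i, b) \<Rightarrow> \<lambda>v. l i b (v i)) (case d' of (i, b) \<Rightarrow> emb i b) =
        (if d = d' then \<one>\<^bsub>K\<^esub> else \<zero>\<^bsub>K\<^esub>)"
      using d B(1)[OF d(2)] by (auto simp: emb_def lz dual_basis_def)
  next
    fix N assume N: "submodule K N ?M" "(\<lambda>(i, b). emb i b) ` Sigma S B \<subseteq> N"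
    interpret N: submodule K N ?M by (rule N)
    have e: "emb i v \<in> N" if i: "i \<in> S" and v: "v \<in> carrier (V i)" for i v
    proof -
      interpret V: vectorspace K "V i" by (rule V[OF i])
      have r: "v \<oplus>\<^bsub>V j\<^esub> \<zero>\<^bsub>V j\<^esub> = v" "c \<odot>\<^bsub>V j\<^esub> \<zero>\<^bsub>V j\<^esub> = \<zero>\<^bsub>V j\<^esub>"
        if "j \<in> S" "v \<in> carrier (V j)" "c \<in> carrier K" for j v c
      proof -
        interpret Vj: vectorspace K "V j" by (rule V[OF that(1)])
        show "v \<oplus>\<^bsub>V j\<^esub> \<zero>\<^bsub>V j\<^esub> = v" "c \<odot>\<^bsub>V j\<^esub> \<zero>\<^bsub>V j\<^esub> = \<zero>\<^bsub>V j\<^esub>" using that by auto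
      qed
      have "submodule K {v \<in> carrier (V i). emb i v \<in> N} (V i)"
      proof (rule submodule.intro[OF V.module_axioms], goal_cases)
        case (2 v w)
        have "emb i (v \<oplus>\<^bsub>V i\<^esub> w) = emb i v \<oplus>\<^bsub>?M\<^esub> emb i w"
          by (auto simp: emb_def finite_direct_sum_def fun_eq_iff zc r(1)[OF _ _ K.zero_closed])
        then show ?case using 2 N.m_closed by simp
      next
        case 3
        have "emb i \<zero>\<^bsub>V i\<^esub> = \<zero>\<^bsub>?M\<^esub>" by (auto simp: emb_def finite_direct_sum_def fun_eq_iff)
        then show ?case using N.zero_closed by simp
      next
        case (4 c v)
        have "emb i (c \<odot>\<^bsub>V i\<^esub> v) = c \<odot>\<^bsub>?M\<^esub> emb i v"
          using 4 by (auto simp: emb_def finite_direct_sum_def fun_eq_iff r(2)[OF _ zc])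
        then show ?case using 4 N.smult_closed by simp
      qed auto
      moreover have "(\<lambda>b. b) ` B i \<subseteq> {v \<in> carrier (V i). emb i v \<in> N}" using N(2) Bc[OF i] i by auto
      ultimately show ?thesis using B(1)[OF i] v unfolding dual_basis_def by blast
    qed
    have "v \<in> N" if v: "v \<in> carrier ?M" for v
    proof -
      have vc: "v j \<in> carrier (V j)" if "j \<in> S" for j using v that by (auto simp: finite_direct_sum_def)
      have lz: "\<zero>\<^bsub>V j\<^esub> \<oplus>\<^bsub>V j\<^esub> v j = v j" "\<zero>\<^bsub>V j\<^esub> \<oplus>\<^bsub>V j\<^esub> \<zero>\<^bsub>V j\<^esub> = \<zero>\<^bsub>V j\<^esub>" "v j \<oplus>\<^bsub>V j\<^esub> \<zero>\<^bsub>V j\<^esub> = v j"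
        if "j \<in> S" for j
      proof -
        interpret V: vectorspace K "V j" by (rule V[OF that])
        show "\<zero>\<^bsub>V j\<^esub> \<oplus>\<^bsub>V j\<^esub> v j = v j" "\<zero>\<^bsub>V j\<^esub> \<oplus>\<^bsub>V j\<^esub> \<zero>\<^bsub>V j\<^esub> = \<zero>\<^bsub>V j\<^esub>" "v j \<oplus>\<^bsub>V j\<^esub> \<zero>\<^bsub>V j\<^esub> = v j"
          using vc[OF that] by auto
      qed
      have "(\<lambda>j\<in>S. if j \<in> A then v j else \<zero>\<^bsub>V j\<^esub>) \<in> N" if "finite A" "A \<subseteq> S" for A
        using that
      proof (induction A rule: finite_induct)
        case empty
        have "(\<lambda>j\<in>S. if j \<in> {} then v j else \<zero>\<^bsub>V j\<^esub>) = \<zero>\<^bsub>?M\<^esub>"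
          by (simp add: finite_direct_sum_def)
        then show ?case using N.zero_closed by (simp only:)
      next
        case (insert a A)
        have "(\<lambda>j\<in>S. if j \<in> insert a A then v j else \<zero>\<^bsub>V j\<^esub>) =
          emb a (v a) \<oplus>\<^bsub>?M\<^esub> (\<lambda>j\<in>S. if j \<in> A then v j else \<zero>\<^bsub>V j\<^esub>)"
          using insert.hyps(2) by (auto simp: emb_def finite_direct_sum_def fun_eq_iff lz)
        also have "\<dots> \<in> N" by (rule N.m_closed) (use insert e vc in \<open>simp_all del: restrict_apply\<close>)
        finally show ?case .
      qed
      from this[OF S] have "(\<lambda>j\<in>S. if j \<in> S then v j else \<zero>\<^bsub>V j\<^esub>) \<in> N" by simp
      moreover have "(\<lambda>j\<in>S. if j \<in> S then v j else \<zero>\<^bsub>V j\<^esub>) = v"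
        using v by (auto simp: finite_direct_sum_def fun_eq_iff PiE_def extensional_def)
      ultimately show ?thesis by simp
    qed
    then show "N = carrier ?M" using N.subset by auto
  qed
  from M.dual_basis_dim(2)[OF this] show ?thesis
    using S Bf B(2) by (simp add: card_SigmaI)
qed

section \<open>Exponents and formal derivatives\<close>

fun unit_exponent :: "nat option \<Rightarrow> exponent" where
  "unit_exponent None = (1, 0)"
| "unit_exponent (Some i) = (0, Poly_Mapping.single i 1)"

text \<open>Reading both components of an exponent through the colours lets the variable z and the
  variables x be treated alike.\<close>

fun coordinate :: "exponent \<Rightarrow> nat option \<Rightarrow> nat" where
  "coordinate e None = fst e"
| "coordinate e (Some i) = Poly_Mapping.lookup (snd e) i"

definition exponent_fact :: "exponent \<Rightarrow> rat" where
  "exponent_fact e = fact (fst e) * (\<Prod>i\<in>Poly_Mapping.keys (snd e). fact (Poly_Mapping.lookup (snd e) i))"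

lemma coordinate_zero [simp]: "coordinate 0 j = 0"
  by (cases j) auto

lemma coordinate_add [simp]: "coordinate (a + b) j = coordinate a j + coordinate b j"
  by (cases j) (auto simp: lookup_add)

lemma coordinate_unit: "coordinate (unit_exponent i) j = of_bool (i = j)"
  by (cases i; cases j) (auto simp: lookup_single)

lemma exponent_eqI: "a = b" if "\<And>j. coordinate a j = coordinate b j" for a b :: exponent
proof (rule prod_eqI)
  show "fst a = fst b" using that[of None] by simp
  show "snd a = snd b" by (rule poly_mapping_eqI) (use that[of "Some _"] in auto)
qed

lemma exponent_minus_unit:
  assumes "coordinate e j > 0"
  obtains e' where "e = e' + unit_exponent j"
proof (cases j)
  case None
  have "e = (fst e - 1, snd e) + unit_exponent j"
    by (rule exponent_eqI) (use assms None in \<open>auto simp: prod_eq_iff\<close>)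
  then show ?thesis by (rule that)
next
  case (Some i)
  have "snd e = (snd e - Poly_Mapping.single i 1) + Poly_Mapping.single i 1"
    by (rule poly_mapping_eqI) (use assms Some in \<open>auto simp: lookup_add lookup_minus lookup_single when_def\<close>)
  then have "e = (fst e, snd e - Poly_Mapping.single i 1) + unit_exponent j"
    using Some by (auto simp: prod_eq_iff)
  then show ?thesis by (rule that)
qed

definition exponent_degree :: "exponent \<Rightarrow> nat" where
  "exponent_degree e = fst e + (\<Sum>i\<in>Poly_Mapping.keys (snd e). Poly_Mapping.lookup (snd e) i)"

lemma exponent_degree_zero [simp]: "exponent_degree 0 = 0"
  by (simp add: exponent_degree_def)

lemma exponent_degree_add_unit: "exponent_degree (e + unit_exponent j) = exponent_degree e + 1"
  using setsum_keys_plus_distrib[of "\<lambda>_ x. x" "snd e" "snd (unit_exponent j)"]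
  by (cases j) (auto simp: exponent_degree_def)

lemma exponent_induct [case_names zero add_unit]:
  assumes "P 0" and step: "\<And>e j. P e \<Longrightarrow> P (e + unit_exponent j)"
  shows "P e"
proof (induction "exponent_degree e" arbitrary: e)
  case 0
  have "coordinate e j = 0" for j
    using exponent_minus_unit[of e j] exponent_degree_add_unit 0 by (metis add_is_0 one_neq_zero neq0_conv)
  then have "e = 0" by (intro exponent_eqI) simp
  then show ?case using assms(1) by simp
next
  case (Suc n)
  have "\<exists>j. coordinate e j > 0"
  proof (rule ccontr)
    assume "\<not> ?thesis"
    then have "e = 0" by (intro exponent_eqI) simp
    then show False using Suc.hyps(2) by (simp add: exponent_degree_def)
  qed
  then obtain j e' where e: "e = e' + unit_exponent j" using exponent_minus_unit by metis
  have "P e'" using Suc exponent_degree_add_unit by (simp add: e)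
  then show ?case using step e by simp
qed

text \<open>Products of series sum over this set, and a sum over an infinite set would be 0. A unit
  added to \<open>e\<close> can be taken off one of the two summands, so the possible first summands
  are among the old ones and their shifts.\<close>

lemma finite_add_eq: "finite {(a, b). a + b = (e :: exponent)}"
proof -
  have "finite {a. \<exists>b. a + b = e}"
  proof (induction e rule: exponent_induct)
    case zero
    have "a = 0" if "a + b = 0" for a b :: exponent
      using that by (metis add_is_0 coordinate_add coordinate_zero exponent_eqI)
    then have "{a. \<exists>b. a + b = (0 :: exponent)} \<subseteq> {0}" by blast
    then show ?case by (rule finite_subset) simp
  next
    case (add_unit e j)
    let ?A = "{a. \<exists>b. a + b = e}"
    have "{a. \<exists>b. a + b = e + unit_exponent j} \<subseteq> ?A \<union> (\<lambda>a. a + unit_exponent j) ` ?A"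
    proof
      fix a assume "a \<in> {a. \<exists>b. a + b = e + unit_exponent j}"
      then obtain b where ab: "a + b = e + unit_exponent j" by blast
      show "a \<in> ?A \<union> (\<lambda>a. a + unit_exponent j) ` ?A"
      proof (rule ccontr)
        assume no: "a \<notin> ?A \<union> (\<lambda>a. a + unit_exponent j) ` ?A"
        have "coordinate b j > 0"
        proof (rule ccontr)
          assume "\<not> coordinate b j > 0"
          then have "coordinate a j > 0"
            using arg_cong[OF ab, of "\<lambda>e. coordinate e j"] by (simp add: coordinate_unit)
          then obtain a' where a': "a = a' + unit_exponent j" by (rule exponent_minus_unit)
          then have "a' + b = e" using ab by (metis add.assoc add.commute add_right_imp_eq)
          then show False using no a' by blast
        qed
        then obtain b' where "b = b' + unit_exponent j" by (rule exponent_minus_unit)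
        then have "a + b' = e" using ab by (metis add.assoc add_right_imp_eq)
        then show False using no by blast
      qed
    qed
    then show ?case by (rule finite_subset) (use add_unit in auto)
  qed
  \<comment> \<open>By cancellation \<open>b\<close> is determined by \<open>a\<close>, so finitely
    many first summands give finitely many pairs.\<close>
  moreover have "{(a, b). a + b = e} \<subseteq> (\<lambda>a. (a, THE b. a + b = e)) ` {a. \<exists>b. a + b = e}"
  proof
    fix x assume "x \<in> {(a, b). a + b = e}"
    then obtain a b where x: "x = (a, b)" and ab: "a + b = e" by blast
    then have "(THE b. a + b = e) = b"
      by (intro the_equality) (auto dest: add_left_imp_eq)
    moreover have "a \<in> {a. \<exists>b. a + b = e}" using ab by blast
    ultimately show "x \<in> (\<lambda>a. (a, THE b. a + b = e)) ` {a. \<exists>b. a + b = e}"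
      unfolding x by (metis (mono_tags, lifting) image_eqI)
  qed
  ultimately show ?thesis using finite_surj by blast
qed

lemma exponent_fact_zero [simp]: "exponent_fact 0 = 1"
  by (simp add: exponent_fact_def)

lemma exponent_fact_nonzero [simp]: "exponent_fact e \<noteq> 0"
  by (simp add: exponent_fact_def)

lemma exponent_fact_add_unit:
  "exponent_fact (e + unit_exponent j) = of_nat (coordinate e j + 1) * exponent_fact e"
proof (cases j)
  case None
  then show ?thesis by (simp add: exponent_fact_def algebra_simps)
next
  case (Some i)
  \<comment> \<open>\<open>i\<close> may be a new key. Over this common index set, the factors
    outside the keys are 0! = 1.\<close>
  let ?A = "insert i (Poly_Mapping.keys (snd e))"
  let ?\<beta> = "snd e + Poly_Mapping.single i 1"
  have k: "Poly_Mapping.keys ?\<beta> \<subseteq> ?A"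
    using keys_add[of "snd e" "Poly_Mapping.single i 1"] by auto
  have "(\<Prod>x\<in>Poly_Mapping.keys ?\<beta>. fact (Poly_Mapping.lookup ?\<beta> x) :: rat) =
      (\<Prod>x\<in>?A. fact (Poly_Mapping.lookup ?\<beta> x))"
    by (rule prod.mono_neutral_left) (use k in \<open>auto simp: in_keys_iff\<close>)
  also have "\<dots> = fact (Poly_Mapping.lookup ?\<beta> i) * (\<Prod>x\<in>?A - {i}. fact (Poly_Mapping.lookup ?\<beta> x))"
    by (rule prod.remove) auto
  also have "(\<Prod>x\<in>?A - {i}. fact (Poly_Mapping.lookup ?\<beta> x) :: rat) =
      (\<Prod>x\<in>?A - {i}. fact (Poly_Mapping.lookup (snd e) x))"
    by (rule prod.cong) (auto simp: lookup_add lookup_single)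
  also have "fact (Poly_Mapping.lookup ?\<beta> i) * \<dots> = of_nat (Poly_Mapping.lookup (snd e) i + 1) *
      (fact (Poly_Mapping.lookup (snd e) i) * \<dots>)"
    by (simp add: lookup_add lookup_single)
  also have "fact (Poly_Mapping.lookup (snd e) i) * (\<Prod>x\<in>?A - {i}. fact (Poly_Mapping.lookup (snd e) x) :: rat) =
      (\<Prod>x\<in>?A. fact (Poly_Mapping.lookup (snd e) x))"
    by (rule prod.remove[symmetric]) auto
  also have "\<dots> = (\<Prod>x\<in>Poly_Mapping.keys (snd e). fact (Poly_Mapping.lookup (snd e) x))"
    by (rule prod.mono_neutral_right) (auto simp: in_keys_iff)
  finally show ?thesis using Some by (simp add: exponent_fact_def)
qed

text \<open>On weights of coloured sets, the derivative in the colour \<open>j\<close> is the insertion of a point of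
  that colour. This reduces the product formula for weights to the Leibniz rule.\<close>

definition exponent_derivative :: "nat option \<Rightarrow> series \<Rightarrow> series" where
  "exponent_derivative j F e = of_nat (coordinate e j + 1) * F (e + unit_exponent j)"

text \<open>Pairs in which \<open>a\<close> has no unit of colour \<open>j\<close> carry the factor
  0. In all others a unit can be taken off \<open>a\<close>.\<close>

lemma sum_weighted_shift:
  fixes H :: "exponent \<Rightarrow> exponent \<Rightarrow> rat"
  shows "(\<Sum>(a, b) | a + b = e + unit_exponent j. of_nat (coordinate a j) * H a b) =
    (\<Sum>(a, b) | a + b = e. of_nat (coordinate a j + 1) * H (a + unit_exponent j) b)"
proof -
  let ?u = "unit_exponent j"
  let ?B = "{(a, b). a + b = e + ?u \<and> coordinate a j > 0}"
  have "(\<Sum>(a, b) | a + b = e + ?u. of_nat (coordinate a j) * H a b) =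
      (\<Sum>(a, b)\<in>?B. of_nat (coordinate a j) * H a b)"
    by (rule sum.mono_neutral_right[OF finite_add_eq]) auto
  also have "?B = (\<lambda>(a, b). (a + ?u, b)) ` {(a, b). a + b = e}"
  proof (intro subset_antisym subsetI)
    fix x assume "x \<in> ?B"
    then obtain a b where x: "x = (a, b)" "a + b = e + ?u" "coordinate a j > 0" by auto
    obtain a' where a': "a = a' + ?u" using x(3) by (rule exponent_minus_unit)
    have "(a' + b) + ?u = e + ?u" using x(2) a' by (simp add: ac_simps)
    then have "a' + b = e" by (rule add_right_imp_eq)
    then show "x \<in> (\<lambda>(a, b). (a + ?u, b)) ` {(a, b). a + b = e}" using x(1) a' by force
  qed (auto simp: coordinate_unit ac_simps)
  also have "(\<Sum>(a, b)\<in>(\<lambda>(a, b). (a + ?u, b)) ` {(a, b). a + b = e}. of_nat (coordinate a j) * H a b) =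
      (\<Sum>(a, b) | a + b = e. of_nat (coordinate a j + 1) * H (a + ?u) b)"
    by (subst sum.reindex)
       (auto simp: inj_on_def coordinate_unit case_prod_unfold dest: add_right_imp_eq intro!: sum.cong)
  finally show ?thesis .
qed

lemma series_mult_commute: "series_mult F G = series_mult G F"
proof
  fix e
  have "series_mult F G e = (\<Sum>x\<in>prod.swap ` {(a, b). a + b = e}. case x of (a, b) \<Rightarrow> G a * F b)"
    unfolding series_mult_def
    by (subst sum.reindex) (auto simp: inj_on_def case_prod_unfold mult.commute)
  also have "prod.swap ` {(a, b). a + b = e} = {(a, b). a + b = e}"
    by (auto simp: add.commute image_iff)
  finally show "series_mult F G e = series_mult G F e" by (simp add: series_mult_def)
qed

text \<open>The factor produced by differentiation is the number of units of colour \<open>j\<close>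
  in a + b. It splits into the numbers for a and for b, and each half is shifted separately.\<close>

lemma exponent_derivative_mult:
  "exponent_derivative j (series_mult F G) e =
     series_mult (exponent_derivative j F) G e + series_mult F (exponent_derivative j G) e"
proof -
  let ?u = "unit_exponent j"
  have half: "(\<Sum>(a, b) | a + b = e + ?u. of_nat (coordinate a j) * (F a * G b)) =
      series_mult (exponent_derivative j F) G e" for F G
    unfolding sum_weighted_shift series_mult_def exponent_derivative_def
    by (intro sum.cong) (auto simp: mult.assoc)
  have swap: "(\<Sum>(a, b) | a + b = e + ?u. of_nat (coordinate b j) * (F a * G b)) =
      (\<Sum>(a, b) | a + b = e + ?u. of_nat (coordinate a j) * (G a * F b))"
    by (rule sum.reindex_bij_witness[of _ prod.swap prod.swap]) (auto simp: add.commute mult.commute)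
  have "exponent_derivative j (series_mult F G) e =
      (\<Sum>(a, b) | a + b = e + ?u. of_nat (coordinate (e + ?u) j) * (F a * G b))"
    by (simp add: exponent_derivative_def series_mult_def sum_distrib_left coordinate_unit case_prod_unfold)
  also have "\<dots> = (\<Sum>(a, b) | a + b = e + ?u. of_nat (coordinate a j) * (F a * G b) +
      of_nat (coordinate b j) * (F a * G b))"
    by (rule sum.cong[OF refl]) (unfold case_prod_unfold mem_Collect_eq, drule sym,
        simp only: coordinate_add of_nat_add distrib_right)
  also have "\<dots> = series_mult (exponent_derivative j F) G e + series_mult (exponent_derivative j G) F e"
    by (simp add: case_prod_unfold sum.distrib half[unfolded case_prod_unfold] swap[unfolded case_prod_unfold])
  finally show ?thesis by (metis series_mult_commute)
qed

section \<open>Weights of coloured sets\<close>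

definition colour_count :: "('a \<Rightarrow> nat option) \<Rightarrow> 'a set \<Rightarrow> exponent" where
  "colour_count c S = (\<Sum>x\<in>S. unit_exponent (c x))"

definition set_weight :: "('a \<Rightarrow> nat option) \<Rightarrow> series \<Rightarrow> 'a set \<Rightarrow> rat" where
  "set_weight c F S = F (colour_count c S) * exponent_fact (colour_count c S)"

lemma colour_count_empty [simp]: "colour_count c {} = 0"
  by (simp add: colour_count_def)

lemma colour_count_insert:
  "\<lbrakk>finite S; x \<notin> S\<rbrakk> \<Longrightarrow> colour_count c (insert x S) = colour_count c S + unit_exponent (c x)"
  by (simp add: colour_count_def add.commute)

lemma coordinate_colour_count: "finite S \<Longrightarrow> coordinate (colour_count c S) j = card {x \<in> S. c x = j}"
proof (induction S rule: finite_induct)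
  case (insert x S)
  have "{y \<in> insert x S. c y = j} = (if c x = j then insert x {y \<in> S. c y = j} else {y \<in> S. c y = j})"
    by auto
  then show ?case using insert by (simp add: colour_count_insert coordinate_unit)
qed simp

lemma colour_count_eq_0_iff: "finite S \<Longrightarrow> colour_count c S = 0 \<longleftrightarrow> S = {}"
proof
  assume S: "finite S" "colour_count c S = 0"
  have "card {x \<in> S. c x = j} = 0" for j
    using coordinate_colour_count[OF S(1), of c j] S(2) by simp
  then show "S = {}" using S(1) by auto
qed simp

lemma set_weight_insert:
  assumes "finite S" "x \<notin> S"
  shows "set_weight c F (insert x S) = set_weight c (exponent_derivative (c x) F) S"
  using assms
  by (simp add: set_weight_def colour_count_insert exponent_derivative_def exponent_fact_add_unit)

lemma sum_Pow_insert:
  assumes "x \<notin> T" "finite T"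
  shows "(\<Sum>S\<in>Pow (insert x T). f S) = (\<Sum>S\<in>Pow T. f (insert x S)) + (\<Sum>S\<in>Pow T. f S)"
proof -
  have "inj_on (insert x) (Pow T)" using assms by (auto simp: inj_on_def)
  moreover have "Pow T \<inter> insert x ` Pow T = {}" using assms by auto
  ultimately show ?thesis
    using assms(2) by (simp add: Pow_insert sum.union_disjoint sum.reindex add.commute)
qed

text \<open>Grouping the subsets by their colour counts would bring in products of binomial
  coefficients. In the induction, the two Leibniz terms are instead the subsets that contain the new
  point and those that do not.\<close>

lemma set_weight_mult:
  assumes "finite T"
  shows "set_weight c (series_mult F G) T = (\<Sum>S\<in>Pow T. set_weight c F S * set_weight c G (T - S))"
  using assms
\<comment> \<open>The series vary, because the induction hypothesis is applied to
  derivatives.\<close>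
proof (induction T arbitrary: F G rule: finite_induct)
  case empty
  have "{(a, b). a + b = (0 :: exponent)} = {(0, 0)}"
    by (auto simp: prod_eq_iff) (metis add_is_0 lookup_add lookup_zero poly_mapping_eqI)+
  then show ?case by (simp add: set_weight_def series_mult_def)
next
  case (insert x T)
  let ?D = "exponent_derivative (c x)"
  have *: "finite S" "x \<notin> S" "insert x T - S = insert x (T - S)" "insert x T - insert x S = T - S"
    "finite (T - S)" "x \<notin> T - S" if "S \<in> Pow T" for S
    using that insert.hyps finite_subset[of S T] by auto
  have "set_weight c (series_mult F G) (insert x T) =
      set_weight c (series_mult (?D F) G) T + set_weight c (series_mult F (?D G)) T"
    using insert.hyps
    by (simp add: set_weight_insert) (simp add: set_weight_def exponent_derivative_mult distrib_right)
  also have "set_weight c (series_mult (?D F) G) T =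
      (\<Sum>S\<in>Pow T. set_weight c F (insert x S) * set_weight c G (insert x T - insert x S))"
    unfolding insert.IH by (rule sum.cong) (simp_all add: * set_weight_insert)
  also have "set_weight c (series_mult F (?D G)) T =
      (\<Sum>S\<in>Pow T. set_weight c F S * set_weight c G (insert x T - S))"
    unfolding insert.IH by (rule sum.cong) (simp_all add: * set_weight_insert)
  finally show ?case
    by (simp only: sum_Pow_insert[OF insert.hyps(2,1)])
qed

section \<open>Powers of a series and partitions with a given number of blocks\<close>

lemma partition_on_insert_block:
  assumes "S \<noteq> {}" "S \<subseteq> T" "partition_on (T - S) I"
  shows "partition_on T (insert S I)" "S \<notin> I"
proof -
  show "S \<notin> I" using assms by (auto simp: partition_on_def)
  show "partition_on T (insert S I)"
    using assms by (auto simp: partition_on_def disjoint_def)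
qed

lemma partition_on_remove_block:
  assumes "partition_on T I" "S \<in> I"
  shows "partition_on (T - S) (I - {S})" "S \<subseteq> T" "S \<noteq> {}"
proof -
  show "S \<subseteq> T" "S \<noteq> {}" using assms by (auto simp: partition_on_def)
  have "\<Union>(I - {S}) = T - S" using assms by (auto simp: partition_on_def disjoint_def)
  then show "partition_on (T - S) (I - {S})" using assms by (auto simp: partition_on_def disjoint_def)
qed

lemma finite_partitions: "finite T \<Longrightarrow> finite {I. partition_on T I \<and> Q I}"
  by (rule finite_subset[OF _ finitely_many_partition_on]) auto

text \<open>The first factor of the power chooses a block, the others a partition of the rest; a
  vanishing constant term excludes the empty block. A partition into n + 1 blocks arises once from
  each of its blocks, which supplies the factor n + 1.\<close>

lemma set_weight_power:
  assumes "finite T" and F: "F 0 = 0"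
  shows "set_weight c (series_power F n) T =
    fact n * (\<Sum>I | partition_on T I \<and> card I = n. \<Prod>s\<in>I. set_weight c F s)"
  using assms(1)
proof (induction n arbitrary: T)
  case 0
  \<comment> \<open>An infinite set also has \<open>card\<close> 0. Partitions of a finite set are
    finite, so only the empty partition is left.\<close>
  have "{I. partition_on T I \<and> card I = 0} = (if T = {} then {{}} else {})"
    using 0 finite_elements[of T] by (auto simp: partition_on_def)
  then show ?case
    using 0 by (simp add: series_power_def series_one_def set_weight_def colour_count_eq_0_iff)
next
  case (Suc n)
  let ?w = "set_weight c F"
  \<comment> \<open>These are pairs of a block and a partition of the rest; \<open>?B\<close> holds
    partitions with one distinguished block. Inserting the block is a bijection between
    them.\<close>
  let ?A = "Sigma (Pow T - {{}}) (\<lambda>S. {I. partition_on (T - S) I \<and> card I = n})"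
  let ?B = "Sigma {I. partition_on T I \<and> card I = Suc n} (\<lambda>I. I)"
  have finI: "finite I" if "partition_on T' I" "T' \<subseteq> T" for I T'
    using that Suc.prems finite_elements finite_subset by metis
  have "set_weight c (series_power F (Suc n)) T =
      (\<Sum>S\<in>Pow T. ?w S * set_weight c (series_power F n) (T - S))"
    using Suc.prems by (simp add: series_power_def set_weight_mult)
  also have "\<dots> = (\<Sum>S\<in>Pow T - {{}}. ?w S * set_weight c (series_power F n) (T - S))"
    by (rule sum.mono_neutral_right) (use Suc.prems F in \<open>auto simp: set_weight_def\<close>)
  also have "\<dots> = fact n * (\<Sum>S\<in>Pow T - {{}}. \<Sum>I | partition_on (T - S) I \<and> card I = n. ?w S * (\<Prod>s\<in>I. ?w s))"
    using Suc.prems by (simp add: Suc.IH sum_distrib_left mult_ac)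
  also have "(\<Sum>S\<in>Pow T - {{}}. \<Sum>I | partition_on (T - S) I \<and> card I = n. ?w S * (\<Prod>s\<in>I. ?w s)) =
      (\<Sum>(S, I)\<in>?A. ?w S * (\<Prod>s\<in>I. ?w s))"
    by (rule sum.Sigma) (use Suc.prems in \<open>auto intro!: finite_partitions\<close>)
  also have "\<dots> = (\<Sum>(I, S)\<in>?B. \<Prod>s\<in>I. ?w s)"
  proof -
    have A: "S \<notin> I" "finite I" "(insert S I, S) \<in> ?B" if "(S, I) \<in> ?A" for S I
    proof -
      from that have a: "S \<noteq> {}" "S \<subseteq> T" "partition_on (T - S) I" "card I = n" by auto
      show "S \<notin> I" "finite I"
        using partition_on_insert_block(2)[OF a(1-3)] finI[OF a(3)] by auto
      then show "(insert S I, S) \<in> ?B"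
        using partition_on_insert_block(1)[OF a(1-3)] a(4) by simp
    qed
    have B: "(S, I - {S}) \<in> ?A" "insert S (I - {S}) = I" if "(I, S) \<in> ?B" for I S
    proof -
      from that have b: "partition_on T I" "S \<in> I" "card I = Suc n" by auto
      have "card (I - {S}) = n" using b finI[OF b(1)] by simp
      then show "(S, I - {S}) \<in> ?A" using partition_on_remove_block[OF b(1,2)] by simp
      show "insert S (I - {S}) = I" using b(2) by auto
    qed
    show ?thesis
    proof (rule sum.reindex_bij_witness[of _ "\<lambda>(I, S). (S, I - {S})" "\<lambda>(S, I). (insert S I, S)"])
      fix a assume "a \<in> ?A"
      then obtain S I where a: "a = (S, I)" "(S, I) \<in> ?A" by (cases a) auto
      show "(case case a of (S, I) \<Rightarrow> (insert S I, S) of (I, S) \<Rightarrow> (S, I - {S})) = a"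
        "(case a of (S, I) \<Rightarrow> (insert S I, S)) \<in> ?B"
        "(case case a of (S, I) \<Rightarrow> (insert S I, S) of (I, S) \<Rightarrow> \<Prod>s\<in>I. ?w s) =
          (case a of (S, I) \<Rightarrow> ?w S * (\<Prod>s\<in>I. ?w s))"
        using A[OF a(2)] by (simp_all add: a(1))
    next
      fix b assume "b \<in> ?B"
      then obtain S I where b: "b = (I, S)" "(I, S) \<in> ?B" by (cases b) auto
      show "(case case b of (I, S) \<Rightarrow> (S, I - {S}) of (S, I) \<Rightarrow> (insert S I, S)) = b"
        "(case b of (I, S) \<Rightarrow> (S, I - {S})) \<in> ?A"
        using B[OF b(2)] by (simp_all add: b(1))
    qed
  qed
  also have "\<dots> = (\<Sum>I | partition_on T I \<and> card I = Suc n. \<Sum>S\<in>I. \<Prod>s\<in>I. ?w s)"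
    by (rule sum.Sigma[symmetric]) (use Suc.prems finite_partitions finI in auto)
  also have "\<dots> = of_nat (Suc n) * (\<Sum>I | partition_on T I \<and> card I = Suc n. \<Prod>s\<in>I. ?w s)"
    by (simp add: sum_distrib_left)
  finally show ?case by (simp only: fact_Suc of_nat_mult mult_ac)
qed

text \<open>Each block has at least one point. This bounds the powers of the inner series that
  contribute to a coefficient of the composition.\<close>

lemma card_partition_le:
  assumes "finite T" "partition_on T I"
  shows "card I \<le> card T"
proof -
  have fin: "finite s" "s \<noteq> {}" if "s \<in> I" for s
    using assms that finite_subset[of s T] by (auto simp: partition_on_def)
  have "card I = (\<Sum>s\<in>I. 1)" by simp
  also have "\<dots> \<le> (\<Sum>s\<in>I. card s)"
    by (rule sum_mono) (use fin in \<open>simp add: Suc_le_eq card_gt_0_iff\<close>)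
  also have "\<dots> = card T" using product_partition[OF assms(2)] fin by simp
  finally show ?thesis .
qed

section \<open>Composition in the variable z\<close>

lemma colour_count_fst_eq_0_iff:
  "finite S \<Longrightarrow> fst (colour_count c S) = 0 \<longleftrightarrow> (\<forall>x\<in>S. c x \<noteq> None)"
  using coordinate_colour_count[of S c None] by auto

lemma exponent_fact_split: "exponent_fact (n, \<beta>) = fact n * exponent_fact (0, \<beta>)"
  by (simp add: exponent_fact_def)

text \<open>\<open>z_coeff\<close> keeps the coefficient of the n-th power of z but moves it to
  exponent 0 of z, so a set with marked points has weight 0. The factor \<open>fact n\<close>
  restores the factorial of the exponent that was removed.\<close>

lemma set_weight_z_coeff:
  assumes "finite U"
  shows "fact n * set_weight c (z_coeff F n) U =
    (if \<forall>x\<in>U. c x \<noteq> None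
     then F (n, snd (colour_count c U)) * exponent_fact (n, snd (colour_count c U)) else 0)"
proof (cases "colour_count c U")
  case (Pair k \<beta>)
  have "k = 0 \<longleftrightarrow> (\<forall>x\<in>U. c x \<noteq> None)" using colour_count_fst_eq_0_iff[OF assms, of c] Pair by simp
  then show ?thesis
    using exponent_fact_split[of n \<beta>] by (cases "k = 0") (auto simp: set_weight_def Pair z_coeff_def mult_ac)
qed

text \<open>The n! in the formula for powers is exactly what completes the factorial of the outer
  coefficient. The outer factor becomes the weight of \<open>U\<close> with n marked points added,
  one for each block.\<close>

lemma set_weight_z_compose:
  assumes T: "finite T" and G: "G 0 = 0"
  shows "set_weight c (z_compose F G) T =
    (\<Sum>U\<in>Pow {x \<in> T. c x \<noteq> None}. \<Sum>I | partition_on (T - U) I.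
       F (card I, snd (colour_count c U)) * exponent_fact (card I, snd (colour_count c U)) *
       (\<Prod>s\<in>I. set_weight c G s))"
proof -
  let ?e = "colour_count c T"
  let ?T = "{x \<in> T. c x \<noteq> None}"
  let ?w = "set_weight c G"
  define t where "t n = series_mult (z_coeff F n) (series_power G n)" for n
  define h where "h U I = F (card I, snd (colour_count c U)) *
    exponent_fact (card I, snd (colour_count c U)) * (\<Prod>s\<in>I. ?w s)" for U I
  have finU: "finite U" if "U \<subseteq> T" for U using that T finite_subset by blast
  have W: "set_weight c (t n) T = (\<Sum>U\<in>Pow ?T. \<Sum>I | partition_on (T - U) I \<and> card I = n. h U I)" for n
  proof -
    have "set_weight c (t n) T = (\<Sum>U\<in>Pow T. set_weight c (z_coeff F n) U * set_weight c (series_power G n) (T - U))"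
      unfolding t_def by (rule set_weight_mult[OF T])
    also have "\<dots> = (\<Sum>U\<in>Pow T. (fact n * set_weight c (z_coeff F n) U) *
        (\<Sum>I | partition_on (T - U) I \<and> card I = n. \<Prod>s\<in>I. ?w s))"
      using T G by (simp add: set_weight_power mult_ac)
    also have "\<dots> = (\<Sum>U\<in>Pow ?T. (fact n * set_weight c (z_coeff F n) U) *
        (\<Sum>I | partition_on (T - U) I \<and> card I = n. \<Prod>s\<in>I. ?w s))"
      by (rule sum.mono_neutral_right) (use T finU in \<open>auto simp: set_weight_z_coeff\<close>)
    also have "\<dots> = (\<Sum>U\<in>Pow ?T. \<Sum>I | partition_on (T - U) I \<and> card I = n. h U I)"
    proof (rule sum.cong[OF refl])
      fix U assume U: "U \<in> Pow ?T"
      then have "finite U" "\<forall>x\<in>U. c x \<noteq> None" using finU by auto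
      then show "(fact n * set_weight c (z_coeff F n) U) *
          (\<Sum>I | partition_on (T - U) I \<and> card I = n. \<Prod>s\<in>I. ?w s) =
          (\<Sum>I | partition_on (T - U) I \<and> card I = n. h U I)"
        by (simp add: set_weight_z_coeff h_def sum_distrib_left)
    qed
    finally show ?thesis .
  qed
  have zero: "t n ?e = 0" if "n > card T" for n
  proof -
    have "{I. partition_on (T - U) I \<and> card I = n} = {}" for U
    proof -
      have "card I \<le> card T" if "partition_on (T - U) I" for I
        using card_partition_le[OF _ that] T card_mono[of T "T - U"] by auto
      then show ?thesis using that by fastforce
    qed
    then have "set_weight c (t n) T = 0" by (simp only: W sum.empty sum.neutral_const)
    then show ?thesis by (simp add: set_weight_def)
  qed
  have "z_compose F G ?e = (\<Sum>n\<in>{..card T}. t n ?e)"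
    unfolding z_compose_def t_def[symmetric]
    by (rule Sum_any.expand_superset) (use zero in \<open>auto simp: not_le[symmetric]\<close>)
  then have "set_weight c (z_compose F G) T = (\<Sum>n\<in>{..card T}. set_weight c (t n) T)"
    by (simp add: set_weight_def sum_distrib_right)
  also have "\<dots> = (\<Sum>U\<in>Pow ?T. \<Sum>n\<in>{..card T}. \<Sum>I | partition_on (T - U) I \<and> card I = n. h U I)"
    unfolding W by (rule sum.swap)
  also have "\<dots> = (\<Sum>U\<in>Pow ?T. \<Sum>I | partition_on (T - U) I. h U I)"
  proof (rule sum.cong[OF refl])
    fix U assume "U \<in> Pow ?T"
    have sub: "card ` {I. partition_on (T - U) I} \<subseteq> {..card T}"
      using card_partition_le[of "T - U"] T card_mono[of T "T - U"] by force
    have "(\<Sum>n\<in>{..card T}. sum (h U) {I \<in> {I. partition_on (T - U) I}. card I = n}) =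
        (\<Sum>I | partition_on (T - U) I. h U I)"
      by (rule sum.group) (use T sub in \<open>auto intro: finitely_many_partition_on\<close>)
    then show "(\<Sum>n\<in>{..card T}. \<Sum>I | partition_on (T - U) I \<and> card I = n. h U I) =
        (\<Sum>I | partition_on (T - U) I. h U I)" by simp
  qed
  finally show ?thesis unfolding h_def .
qed

text \<open>The inverse removes the singletons of \<open>U\<close>. Forbidding other singletons from
  \<open>V\<close> makes \<open>U\<close> recoverable, as the set of points of \<open>V\<close> that
  are blocks by themselves.\<close>

lemma partition_on_split_singletons:
  assumes U: "U \<subseteq> T" and UV: "U \<subseteq> V"
  shows "bij_betw (\<lambda>I. I \<union> (\<lambda>x. {x}) ` U)
    {I. partition_on (T - U) I \<and> (\<forall>x\<in>V. {x} \<notin> I)}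
    {I. partition_on T I \<and> {x \<in> V. {x} \<in> I} = U}"
proof -
  let ?s = "\<lambda>U. (\<lambda>x. {x}) ` U"
  show ?thesis
  proof (rule bij_betw_byWitness[where f' = "\<lambda>I. I - ?s U"])
    have d: "I \<inter> ?s U = {}" if "partition_on (T - U) I" for I
      using that by (auto simp: partition_on_def)
    show "\<forall>I\<in>{I. partition_on (T - U) I \<and> (\<forall>x\<in>V. {x} \<notin> I)}. I \<union> ?s U - ?s U = I"
      using d by blast
    show "\<forall>I\<in>{I. partition_on T I \<and> {x \<in> V. {x} \<in> I} = U}. I - ?s U \<union> ?s U = I"
      by auto
    show "(\<lambda>I. I \<union> ?s U) ` {I. partition_on (T - U) I \<and> (\<forall>x\<in>V. {x} \<notin> I)} \<subseteq>
        {I. partition_on T I \<and> {x \<in> V. {x} \<in> I} = U}"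
    proof (intro image_subsetI CollectI conjI)
      fix I assume "I \<in> {I. partition_on (T - U) I \<and> (\<forall>x\<in>V. {x} \<notin> I)}"
      then have I: "partition_on (T - U) I" "\<forall>x\<in>V. {x} \<notin> I" by auto
      show "partition_on T (I \<union> ?s U)"
        unfolding partition_on_def
      proof (intro conjI)
        have dis: "disjoint I" and Un: "\<Union>I = T - U" using I(1) by (auto simp: partition_on_def)
        show "disjoint (I \<union> ?s U)"
        proof (rule disjointI)
          fix a b assume "a \<in> I \<union> ?s U" "b \<in> I \<union> ?s U" "a \<noteq> b"
          then show "a \<inter> b = {}" using disjointD[OF dis] Un by (elim UnE) blast+
        qed
        show "\<Union>(I \<union> ?s U) = T" using Un U by auto
      qed (use I(1) in \<open>auto simp: partition_on_def\<close>)
      show "{x \<in> V. {x} \<in> I \<union> ?s U} = U" using I(2) UV by auto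
    qed
    show "(\<lambda>I. I - ?s U) ` {I. partition_on T I \<and> {x \<in> V. {x} \<in> I} = U} \<subseteq>
        {I. partition_on (T - U) I \<and> (\<forall>x\<in>V. {x} \<notin> I)}"
    proof (intro image_subsetI CollectI conjI)
      fix I assume "I \<in> {I. partition_on T I \<and> {x \<in> V. {x} \<in> I} = U}"
      then have I: "partition_on T I" "{x \<in> V. {x} \<in> I} = U" by auto
      have dis: "disjoint I" using I(1) by (auto simp: partition_on_def)
      have no: "x \<notin> s" if "x \<in> U" "s \<in> I - ?s U" for x s
      proof -
        have "{x} \<in> I" using I(2) that(1) by auto
        then show ?thesis using disjointD[OF dis, of "{x}" s] that by auto
      qed
      have "\<Union>(I - ?s U) = T - U"
        using I no by (auto simp: partition_on_def)
      then show "partition_on (T - U) (I - ?s U)"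
        using I(1) by (auto simp: partition_on_def disjoint_def)
      show "\<forall>x\<in>V. {x} \<notin> I - ?s U" using I(2) by auto
    qed
  qed
qed

text \<open>By \<open>G1\<close>, partitions of \<open>T - U\<close> in which an unmarked point is a
  block contribute nothing, so \<open>U\<close> and a partition of \<open>T - U\<close> merge into
  one partition of \<open>T\<close>. The exponent \<open>e I\<close> is the colour count of the
  contraction by \<open>I\<close>, as \<open>colour_count_contracted\<close> shows.\<close>

lemma set_weight_z_compose_partitions:
  fixes c :: "'a \<Rightarrow> nat option" and F G :: series and T :: "'a set"
  defines "V \<equiv> {x \<in> T. c x \<noteq> None}"
  defines "e \<equiv> \<lambda>I. (card (I - (\<lambda>x. {x}) ` V), snd (colour_count c {x \<in> V. {x} \<in> I}))"
  assumes T: "finite T" and G: "G 0 = 0" and G1: "\<And>x. x \<in> V \<Longrightarrow> set_weight c G {x} = 0"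
  shows "set_weight c (z_compose F G) T = (\<Sum>I | partition_on T I.
    F (e I) * exponent_fact (e I) * (\<Prod>s\<in>I - (\<lambda>x. {x}) ` V. set_weight c G s))"
proof -
  let ?s = "\<lambda>U. (\<lambda>x. {x}) ` U"
  let ?w = "set_weight c G"
  let ?f = "\<lambda>I. F (e I) * exponent_fact (e I) * (\<Prod>s\<in>I - ?s V. ?w s)"
  define h where "h U I = F (card I, snd (colour_count c U)) *
    exponent_fact (card I, snd (colour_count c U)) * (\<Prod>s\<in>I. ?w s)" for U and I :: "'a set set"
  have fin: "finite {I. partition_on S I \<and> Q I}" if "S \<subseteq> T" for S Q
    using that T finite_partitions finite_subset by metis
  have "(\<Sum>I | partition_on (T - U) I. h U I) = (\<Sum>I | partition_on T I \<and> {x \<in> V. {x} \<in> I} = U. ?f I)"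
    if U: "U \<in> Pow V" for U
  proof -
    have UT: "U \<subseteq> V" "U \<subseteq> T" using U by (auto simp: V_def)
    have "(\<Sum>I | partition_on (T - U) I. h U I) =
        (\<Sum>I | partition_on (T - U) I \<and> (\<forall>x\<in>V. {x} \<notin> I). h U I)"
    proof (rule sum.mono_neutral_right)
      show "finite {I. partition_on (T - U) I}" using fin[of "T - U" "\<lambda>_. True"] by auto
      show "\<forall>I\<in>{I. partition_on (T - U) I} - {I. partition_on (T - U) I \<and> (\<forall>x\<in>V. {x} \<notin> I)}. h U I = 0"
      proof
        fix I assume "I \<in> {I. partition_on (T - U) I} - {I. partition_on (T - U) I \<and> (\<forall>x\<in>V. {x} \<notin> I)}"
        then obtain x where x: "partition_on (T - U) I" "x \<in> V" "{x} \<in> I" by blast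
        have "finite I" using x(1) T finite_elements by blast
        then have "(\<Prod>s\<in>I. ?w s) = 0" using x(3) G1[OF x(2)] by (intro prod_zero) auto
        then show "h U I = 0" by (simp add: h_def)
      qed
    qed auto
    also have "\<dots> = (\<Sum>I | partition_on (T - U) I \<and> (\<forall>x\<in>V. {x} \<notin> I). ?f (I \<union> ?s U))"
    proof (rule sum.cong[OF refl])
      fix I assume "I \<in> {I. partition_on (T - U) I \<and> (\<forall>x\<in>V. {x} \<notin> I)}"
      then have no: "\<forall>x\<in>V. {x} \<notin> I" by auto
      have "I \<union> ?s U - ?s V = I" "{x \<in> V. {x} \<in> I \<union> ?s U} = U" using no UT by auto
      then show "h U I = ?f (I \<union> ?s U)" by (simp add: h_def e_def)
    qed
    also have "\<dots> = (\<Sum>I | partition_on T I \<and> {x \<in> V. {x} \<in> I} = U. ?f I)"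
      by (rule sum.reindex_bij_betw[OF partition_on_split_singletons[OF UT(2,1)]])
    finally show ?thesis .
  qed
  then have "set_weight c (z_compose F G) T =
      (\<Sum>U\<in>Pow V. \<Sum>I | partition_on T I \<and> {x \<in> V. {x} \<in> I} = U. ?f I)"
    unfolding set_weight_z_compose[where F = F and G = G, OF T G] V_def[symmetric] h_def[symmetric] by simp
  also have "\<dots> = (\<Sum>U\<in>Pow V. sum ?f {I \<in> {I. partition_on T I}. {x \<in> V. {x} \<in> I} = U})"
    by simp
  \<comment> \<open>Each partition belongs to exactly one \<open>U\<close>.\<close>
  also have "\<dots> = (\<Sum>I | partition_on T I. ?f I)"
    by (rule sum.group) (use T fin[of T "\<lambda>_. True"] in \<open>auto simp: V_def\<close>)
  finally show ?thesis .
qed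

section \<open>Colourings and pointed partitions\<close>

definition coloured :: "(nat \<Rightarrow> nat option) \<Rightarrow> nat set \<Rightarrow> ppart" where
  "coloured c T = PPart {x \<in> T. c x = None} (range (\<lambda>i. {x \<in> T. c x = Some i}) - {{}})"

lemma Union_parts_coloured: "\<Union>(parts (coloured c T)) = {x \<in> T. c x \<noteq> None}"
proof -
  have "\<Union>(parts (coloured c T)) = \<Union>(range (\<lambda>i. {x \<in> T. c x = Some i}))"
    unfolding coloured_def ppart.sel by blast
  then show ?thesis by auto
qed

lemma ground_coloured [simp]: "ground (coloured c T) = T"
  unfolding ground_def Union_parts_coloured by (auto simp: coloured_def)

lemma pointed_partition_coloured:
  assumes "finite T" shows "pointed_partition (coloured c T)"
  unfolding pointed_partition_def partition_on_def Union_parts_coloured ground_coloured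
  using assms by (auto simp: coloured_def disjoint_def)

text \<open>Lets empty colour classes be dropped once, at the end, when parts are restricted or
  contracted.\<close>

lemma image_minus_empty: "f {} = {} \<Longrightarrow> f ` (A - {{}}) - {{}} = f ` A - {{}}"
  by (auto; metis Diff_iff image_eqI singletonD)

lemma induced_coloured: "induced (coloured c T) S = coloured c (T \<inter> S)"
proof -
  have "(\<lambda>A. A \<inter> S) ` (range (\<lambda>i. {x \<in> T. c x = Some i}) - {{}}) - {{}} =
      (\<lambda>A. A \<inter> S) ` range (\<lambda>i. {x \<in> T. c x = Some i}) - {{}}" by (rule image_minus_empty) simp
  also have "(\<lambda>A. A \<inter> S) ` range (\<lambda>i. {x \<in> T. c x = Some i}) = range (\<lambda>i. {x \<in> T \<inter> S. c x = Some i})"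
    unfolding image_image by (rule image_cong) auto
  finally show ?thesis by (auto simp: induced_def coloured_def)
qed

definition contracted_colour :: "(nat \<Rightarrow> nat option) \<Rightarrow> nat \<Rightarrow> nat option" where
  "contracted_colour c n = (if card (set_decode n) = 1 then c (the_elem (set_decode n)) else None)"

lemma contracted_colour_encode:
  assumes "finite s"
  shows "contracted_colour c (set_encode s) = None \<longleftrightarrow> \<not> (\<exists>x. s = {x} \<and> c x \<noteq> None)"
    and "contracted_colour c (set_encode s) = Some i \<longleftrightarrow> (\<exists>x. s = {x} \<and> c x = Some i)"
  using assms by (auto simp: contracted_colour_def card_1_singleton_iff)

lemma partition_on_blocks:
  assumes "finite T" "partition_on T I" "s \<in> I"
  shows "finite s" "s \<noteq> {}" "s \<subseteq> T"
  using assms finite_subset[of s T] by (auto simp: partition_on_def)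

text \<open>Contraction stays within colourings: a singleton block inherits the colour of its point,
  and every larger block becomes a marked point.\<close>

lemma contracted_coloured:
  assumes T: "finite T" and I: "partition_on T I"
  shows "contracted (coloured c T) I = coloured (contracted_colour c) (set_encode ` I)"
proof -
  note blocks = partition_on_blocks[OF T I]
  have m: "card s = 1 \<and> s \<subseteq> {x \<in> T. c x = None} \<or> card s > 1 \<longleftrightarrow> contracted_colour c (set_encode s) = None"
    if "s \<in> I" for s
  proof (cases "card s = 1")
    case True
    then obtain x where "s = {x}" by (rule card_1_singletonE)
    then show ?thesis using blocks[OF that] contracted_colour_encode(1)[of s c] by auto
  next
    case False
    moreover have "card s > 0" using blocks[OF that] by (simp add: card_gt_0_iff)
    ultimately show ?thesis using blocks[OF that] by (auto simp: contracted_colour_encode)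
  qed
  have p: "card s = 1 \<and> s \<subseteq> {x \<in> T. c x = Some i} \<longleftrightarrow> contracted_colour c (set_encode s) = Some i"
    if "s \<in> I" for s i
    using blocks[OF that] by (auto simp: contracted_colour_encode card_1_singleton_iff)
  have im: "set_encode ` {s \<in> I. Q s} = {n \<in> set_encode ` I. R n}" if "\<And>s. s \<in> I \<Longrightarrow> Q s = R (set_encode s)" for Q R
    using that by auto
  let ?f = "\<lambda>A. set_encode ` {s \<in> I. card s = 1 \<and> s \<subseteq> A}"
  have "?f ` (range (\<lambda>i. {x \<in> T. c x = Some i}) - {{}}) - {{}} = ?f ` range (\<lambda>i. {x \<in> T. c x = Some i}) - {{}}"
    by (rule image_minus_empty) auto
  also have "?f ` range (\<lambda>i. {x \<in> T. c x = Some i}) =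
      range (\<lambda>i. {n \<in> set_encode ` I. contracted_colour c n = Some i})"
    unfolding image_image by (rule image_cong[OF refl], rule im) (rule p)
  finally have parts: "?f ` (range (\<lambda>i. {x \<in> T. c x = Some i}) - {{}}) - {{}} =
      range (\<lambda>i. {n \<in> set_encode ` I. contracted_colour c n = Some i}) - {{}}" .
  show ?thesis
    unfolding contracted_def coloured_def ppart.sel parts by (rule arg_cong2[of _ _ _ _ PPart], rule im, rule m) simp_all
qed

text \<open>The only blocks that do not become marked points are the unmarked singletons. They are
  counted through the points they consist of.\<close>

lemma colour_count_contracted:
  fixes c :: "nat \<Rightarrow> nat option" and T :: "nat set"
  defines "V \<equiv> {x \<in> T. c x \<noteq> None}"
  assumes T: "finite T" and I: "partition_on T I"
  shows "colour_count (contracted_colour c) (set_encode ` I) =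
    (card (I - (\<lambda>x. {x}) ` V), snd (colour_count c {x \<in> V. {x} \<in> I}))"
proof (rule exponent_eqI)
  fix j
  note blocks = partition_on_blocks[OF T I]
  have fin: "finite (set_encode ` I)" using finite_elements[OF T I] by simp
  have inj: "inj_on set_encode I"
    by (rule inj_on_subset[OF inj_on_set_encode]) (use blocks in auto)
  have finV: "finite {x \<in> V. {x} \<in> I}" using T by (simp add: V_def)
  show "coordinate (colour_count (contracted_colour c) (set_encode ` I)) j =
      coordinate (card (I - (\<lambda>x. {x}) ` V), snd (colour_count c {x \<in> V. {x} \<in> I})) j"
  proof (cases j)
    case None
    have "{n \<in> set_encode ` I. contracted_colour c n = None} =
        set_encode ` {s \<in> I. contracted_colour c (set_encode s) = None}" by auto
    also have "contracted_colour c (set_encode s) = None \<longleftrightarrow> s \<notin> (\<lambda>x. {x}) ` V" if "s \<in> I" for s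
      unfolding contracted_colour_encode(1)[OF blocks(1)[OF that]]
      using blocks(3)[OF that] by (auto simp: V_def)
    then have "{s \<in> I. contracted_colour c (set_encode s) = None} = I - (\<lambda>x. {x}) ` V" by blast
    finally have "{n \<in> set_encode ` I. contracted_colour c n = None} = set_encode ` (I - (\<lambda>x. {x}) ` V)" .
    then show ?thesis
      using card_image[OF inj_on_subset[OF inj, of "I - (\<lambda>x. {x}) ` V"]]
      unfolding None coordinate_colour_count[OF fin] by simp
  next
    case (Some i)
    let ?B = "{x \<in> {x \<in> V. {x} \<in> I}. c x = Some i}"
    have "{n \<in> set_encode ` I. contracted_colour c n = Some i} =
        set_encode ` {s \<in> I. contracted_colour c (set_encode s) = Some i}" by auto
    also have "contracted_colour c (set_encode s) = Some i \<longleftrightarrow> s \<in> (\<lambda>x. {x}) ` ?B" if "s \<in> I" for s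
      unfolding contracted_colour_encode(2)[OF blocks(1)[OF that]]
      using that blocks(3)[OF that] by (auto simp: V_def)
    then have "{s \<in> I. contracted_colour c (set_encode s) = Some i} = (\<lambda>x. {x}) ` ?B" by blast
    finally have "{n \<in> set_encode ` I. contracted_colour c n = Some i} = (\<lambda>x. set_encode {x}) ` ?B"
      by (simp only: image_image)
    moreover have "inj_on (\<lambda>x. set_encode {x}) ?B"
      using inj_onD[OF inj] by (intro inj_onI) blast
    ultimately have "coordinate (colour_count (contracted_colour c) (set_encode ` I)) j =
        coordinate (colour_count c {x \<in> V. {x} \<in> I}) (Some i)"
      unfolding coordinate_colour_count[OF fin] coordinate_colour_count[OF finV] Some
      by (simp only: card_image)
    then show ?thesis using Some by simp
  qed
qed

text \<open>The integer partition \<lambda> whose monomial symmetric function contains the monomial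
  in x with the given exponents.\<close>

definition part_sizes :: "exponent \<Rightarrow> nat multiset" where
  "part_sizes e = image_mset (Poly_Mapping.lookup (snd e)) (mset_set (Poly_Mapping.keys (snd e)))"

lemma coloured_type:
  assumes T: "finite T"
  shows "card (marked (coloured c T)) = fst (colour_count c T)"
    and "image_mset card (mset_set (parts (coloured c T))) = part_sizes (colour_count c T)"
proof -
  let ?\<alpha> = "snd (colour_count c T)"
  let ?A = "\<lambda>i. {x \<in> T. c x = Some i}"
  show "card (marked (coloured c T)) = fst (colour_count c T)"
    using coordinate_colour_count[OF T, of c None] by (simp add: coloured_def)
  have l': "Poly_Mapping.lookup ?\<alpha> = (\<lambda>i. card (?A i))"
    using coordinate_colour_count[OF T, of c "Some _"] by auto
  then have l: "Poly_Mapping.lookup ?\<alpha> i = card (?A i)" for i by simp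
  have k: "Poly_Mapping.keys ?\<alpha> = {i. ?A i \<noteq> {}}"
    using T by (auto simp: in_keys_iff l)
  have p: "parts (coloured c T) = ?A ` Poly_Mapping.keys ?\<alpha>"
    unfolding k by (auto simp: coloured_def)
  have "inj_on ?A (Poly_Mapping.keys ?\<alpha>)"
  proof (rule inj_onI)
    fix i j assume "i \<in> Poly_Mapping.keys ?\<alpha>" "?A i = ?A j"
    moreover from this obtain x where "x \<in> ?A i" unfolding k by blast
    ultimately show "i = j" by force
  qed
  then have "mset_set (parts (coloured c T)) = image_mset ?A (mset_set (Poly_Mapping.keys ?\<alpha>))"
    by (simp add: p image_mset_mset_set)
  then show "image_mset card (mset_set (parts (coloured c T))) = part_sizes (colour_count c T)"
    by (simp add: part_sizes_def multiset.map_comp comp_def l')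
qed

text \<open>Bijections between corresponding fibres are glued. This matches parts with variables by
  size, and points with points by colour.\<close>

lemma bij_betw_same_fibres:
  assumes A: "finite A" and B: "finite B"
    and eq: "\<And>v. card {a \<in> A. f a = v} = card {b \<in> B. g b = v}"
  obtains h where "bij_betw h A B" "\<And>a. a \<in> A \<Longrightarrow> g (h a) = f a"
proof -
  have "\<exists>h. bij_betw h {a \<in> A. f a = v} {b \<in> B. g b = v}" for v
    by (rule finite_same_card_bij) (use A B eq in auto)
  then obtain h where h: "\<And>v. bij_betw (h v) {a \<in> A. f a = v} {b \<in> B. g b = v}" by metis
  have hB: "h (f a) a \<in> B" "g (h (f a) a) = f a" if "a \<in> A" for a
    using bij_betwE[OF h[of "f a"]] that by auto
  have "bij_betw (\<lambda>a. h (f a) a) A B"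
    unfolding bij_betw_def
  proof (intro conjI subset_antisym subsetI)
    show "inj_on (\<lambda>a. h (f a) a) A"
    proof (rule inj_onI)
      fix x y assume xy: "x \<in> A" "y \<in> A" "h (f x) x = h (f y) y"
      then have "f x = f y" using hB(2) by metis
      then show "x = y" using bij_betw_imp_inj_on[OF h[of "f x"]] xy by (auto simp: inj_on_def)
    qed
  next
    fix b assume b: "b \<in> B"
    then have "b \<in> h (g b) ` {a \<in> A. f a = g b}" using bij_betw_imp_surj_on[OF h[of "g b"]] by auto
    then obtain a where "a \<in> A" "f a = g b" "b = h (g b) a" by auto
    then show "b \<in> (\<lambda>a. h (f a) a) ` A" by (intro image_eqI[of _ _ a]) auto
  qed (use hB in auto)
  then show ?thesis using hB(2) by (rule that)
qed

lemma card_fibre_eq_count: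
  "finite A \<Longrightarrow> card {a \<in> A. f a = v} = count (image_mset f (mset_set A)) v"
proof (induction A rule: finite_induct)
  case (insert x A)
  have "{a \<in> insert x A. f a = v} = (if f x = v then insert x {a \<in> A. f a = v} else {a \<in> A. f a = v})"
    by auto
  then show ?case using insert by simp
qed simp

text \<open>Parts carry no labels, so they are matched by size with the variables occurring in
  \<open>e\<close>, whose indices then serve as colours.\<close>

lemma coloured_exists:
  assumes J: "pointed_partition J" and m: "card (marked J) = fst e"
    and p: "image_mset card (mset_set (parts J)) = part_sizes e"
  obtains c where "J = coloured c (ground J)" "colour_count c (ground J) = e"
proof -
  let ?K = "Poly_Mapping.keys (snd e)"
  have fin: "finite (ground J)" and part: "partition_on (ground J - marked J) (parts J)"
    using J by (auto simp: pointed_partition_def)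
  have finp: "finite (parts J)" using finite_elements[OF _ part] fin by simp
  have fibre: "card {i \<in> ?K. Poly_Mapping.lookup (snd e) i = v} = card {A \<in> parts J. card A = v}" for v
    by (simp add: card_fibre_eq_count[OF finite_keys] card_fibre_eq_count[OF finp] p part_sizes_def)
  obtain h where h: "bij_betw h ?K (parts J)" "\<And>i. i \<in> ?K \<Longrightarrow> card (h i) = Poly_Mapping.lookup (snd e) i"
    using bij_betw_same_fibres[OF finite_keys finp fibre] by blast
  have hp: "h i \<in> parts J" if "i \<in> ?K" for i using h(1) that by (auto simp: bij_betw_def)
  have dis: "i = j" if "i \<in> ?K" "j \<in> ?K" "x \<in> h i" "x \<in> h j" for i j x
  proof -
    have "h i = h j"
      using disjointD[OF partition_onD2[OF part] hp[OF that(1)] hp[OF that(2)]] that(3,4) by blast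
    then show ?thesis using h(1) that(1,2) by (auto simp: bij_betw_def inj_on_def)
  qed
  have sub: "h i \<subseteq> ground J" "h i \<inter> marked J = {}" "h i \<noteq> {}" if "i \<in> ?K" for i
    using part hp[OF that] by (auto simp: partition_on_def)
  define c where "c x = (if \<exists>i\<in>?K. x \<in> h i then Some (THE i. i \<in> ?K \<and> x \<in> h i) else None)" for x
  have c: "c x = Some i" if "i \<in> ?K" "x \<in> h i" for x i
  proof -
    have "(THE i. i \<in> ?K \<and> x \<in> h i) = i" by (rule the_equality) (use that dis in auto)
    then show ?thesis using that by (auto simp: c_def)
  qed
  have cS: "c x = Some i \<longleftrightarrow> i \<in> ?K \<and> x \<in> h i" for x i
  proof
    assume "c x = Some i"
    moreover from this obtain i' where "i' \<in> ?K" "x \<in> h i'" by (auto simp: c_def split: if_splits)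
    ultimately show "i \<in> ?K \<and> x \<in> h i" using c by auto
  qed (use c in auto)
  have "x \<in> marked J \<longleftrightarrow> x \<in> ground J \<and> c x = None" for x
  proof -
    have "c x = None \<longleftrightarrow> (\<forall>i\<in>?K. x \<notin> h i)" by (auto simp: c_def)
    also have "\<dots> \<longleftrightarrow> x \<notin> \<Union>(parts J)" using h(1) by (auto simp: bij_betw_def)
    also have "\<Union>(parts J) = ground J - marked J" using part by (auto simp: partition_on_def)
    finally show ?thesis by (auto simp: ground_def)
  qed
  then have mJ: "marked J = {x \<in> ground J. c x = None}" by auto
  have fib: "{x \<in> ground J. c x = Some i} = (if i \<in> ?K then h i else {})" for i
    using sub by (auto simp: cS)
  have "parts J = range (\<lambda>i. {x \<in> ground J. c x = Some i}) - {{}}"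
    unfolding fib using h(1) partition_onD3[OF part] by (auto simp: bij_betw_def split: if_splits)
  with mJ have Jc: "J = coloured c (ground J)" by (simp add: coloured_def ppart.expand)
  have "colour_count c (ground J) = e"
  proof (rule exponent_eqI)
    fix j
    show "coordinate (colour_count c (ground J)) j = coordinate e j"
      unfolding coordinate_colour_count[OF fin]
      by (cases j) (auto simp: mJ[symmetric] m fib h(2) in_keys_iff)
  qed
  with Jc show ?thesis by (rule that)
qed

text \<open>Ensures that the choice in \<open>value_dim\<close> ranges over a nonempty class of
  pointed partitions.\<close>

lemma colour_count_exists: "\<exists>c (T :: nat set). finite T \<and> colour_count c T = e"
proof (induction e rule: exponent_induct)
  case zero
  show ?case by (intro exI[of _ "\<lambda>_. None"] exI[of _ "{}"]) simp
next
  case (add_unit e j)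
  then obtain c and T :: "nat set" where T: "finite T" "colour_count c T = e" by blast
  obtain x where x: "x \<notin> T" using ex_new_if_finite[OF infinite_UNIV_nat T(1)] by blast
  have "colour_count (c(x := j)) T = colour_count c T"
    unfolding colour_count_def by (rule sum.cong) (use x in auto)
  then have "colour_count (c(x := j)) (insert x T) = e + unit_exponent j"
    using T x by (simp add: colour_count_insert)
  then show ?case using T(1) finite_insert by blast
qed

text \<open>For the contraction product this replaces the independence of the chosen representative, so that
  its functoriality is never needed.\<close>

lemma value_dim_some:
  obtains c T where "finite T" "colour_count c T = e"
    "value_dim K P (fst e) (part_sizes e) = vectorspace.dim K (obj P (coloured c T))"
proof -
  define J where "J = (SOME J. pointed_partition J \<and> card (marked J) = fst e \<and>
    image_mset card (mset_set (parts J)) = part_sizes e)"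
  obtain c0 and T0 :: "nat set" where T0: "finite T0" "colour_count c0 T0 = e"
    using colour_count_exists by blast
  have "pointed_partition J \<and> card (marked J) = fst e \<and> image_mset card (mset_set (parts J)) = part_sizes e"
    unfolding J_def by (rule someI[of _ "coloured c0 T0"])
      (use T0 coloured_type[OF T0(1), of c0] pointed_partition_coloured in auto)
  then have J: "pointed_partition J" "card (marked J) = fst e" "image_mset card (mset_set (parts J)) = part_sizes e"
    by auto
  obtain c where c: "J = coloured c (ground J)" "colour_count c (ground J) = e"
    using coloured_exists[OF J] .
  have "finite (ground J)" using J(1) by (simp add: pointed_partition_def)
  moreover have "value_dim K P (fst e) (part_sizes e) = vectorspace.dim K (obj P (coloured c (ground J)))"
    using c(1) by (simp add: value_dim_def J_def)
  ultimately show ?thesis using c(2) that by blast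
qed

section \<open>Invariance of dimensions under isomorphism\<close>

lemma coloured_isomorphism:
  assumes T: "finite T" and T': "finite T'" and eq: "colour_count c T = colour_count c' T'"
  obtains f g where "f \<in> pp_hom (coloured c T) (coloured c' T')"
    "g \<in> pp_hom (coloured c' T') (coloured c T)"
    "compose T g f = (\<lambda>x\<in>T. x)" "compose T' f g = (\<lambda>x\<in>T'. x)"
proof -
  have hom: "f \<in> pp_hom (coloured c T) (coloured c' T')"
    if f: "bij_betw f T T'" "f \<in> extensional T" "\<And>x. x \<in> T \<Longrightarrow> c' (f x) = c x" for f c c' T T'
  proof -
    have im: "f ` {x \<in> T. c x = i} = {y \<in> T'. c' y = i}" for i
      using f(1,3) by (auto simp: bij_betw_def)
    have "(`) f ` (range (\<lambda>i. {x \<in> T. c x = Some i}) - {{}}) =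
        (`) f ` range (\<lambda>i. {x \<in> T. c x = Some i}) - {{}}" by auto
    also have "\<dots> = range (\<lambda>i. {y \<in> T'. c' y = Some i}) - {{}}"
      by (simp add: image_image im)
    finally show ?thesis
      using f(1,2) im[of None] unfolding pp_hom_def ground_coloured by (simp add: coloured_def)
  qed
  have fibre: "card {x \<in> T. c x = j} = card {y \<in> T'. c' y = j}" for j
    using coordinate_colour_count[OF T, of c j] coordinate_colour_count[OF T', of c' j] eq by simp
  obtain h where h: "bij_betw h T T'" "\<And>x. x \<in> T \<Longrightarrow> c' (h x) = c x"
    by (rule bij_betw_same_fibres[OF T T' fibre]) (rule that)
  let ?g = "inv_into T h"
  have g: "bij_betw ?g T' T" by (rule bij_betw_inv_into[OF h(1)])
  have hg: "h (?g y) = y" if "y \<in> T'" for y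
    using bij_betw_inv_into_right[OF h(1) that] .
  have gh: "?g (h x) = x" if "x \<in> T" for x
    using bij_betw_inv_into_left[OF h(1) that] .
  have hT: "h x \<in> T'" if "x \<in> T" for x using h(1) that by (auto simp: bij_betw_def)
  have gT: "?g y \<in> T" if "y \<in> T'" for y using g that by (auto simp: bij_betw_def)
  have gc: "c (?g y) = c' y" if "y \<in> T'" for y using h(2)[OF gT[OF that]] hg[OF that] by simp
  show ?thesis
  proof (rule that[of "restrict h T" "restrict ?g T'"])
    show "restrict h T \<in> pp_hom (coloured c T) (coloured c' T')"
      by (rule hom) (use h in \<open>auto cong: bij_betw_cong\<close>)
    show "restrict ?g T' \<in> pp_hom (coloured c' T') (coloured c T)"
      by (rule hom) (use g gc in \<open>auto cong: bij_betw_cong\<close>)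
    show "compose T (restrict ?g T') (restrict h T) = (\<lambda>x\<in>T. x)"
      by (auto simp: compose_def gh hT)
    show "compose T' (restrict h T) (restrict ?g T') = (\<lambda>x\<in>T'. x)"
      by (auto simp: compose_def hg gT)
  qed
qed

text \<open>Functoriality turns mutually inverse morphisms into mutually inverse linear maps in the
  opposite direction.\<close>

lemma (in pointed_collection) dim_coloured_cong:
  assumes T: "finite T" and T': "finite T'" and eq: "colour_count c T = colour_count c' T'"
  shows "vectorspace.dim K (obj P (coloured c T)) = vectorspace.dim K (obj P (coloured c' T'))"
proof -
  let ?J = "coloured c T" and ?J' = "coloured c' T'"
  have J: "pointed_partition ?J" "pointed_partition ?J'" using pointed_partition_coloured T T' by auto
  obtain f g where fg: "f \<in> pp_hom ?J ?J'" "g \<in> pp_hom ?J' ?J"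
    "compose T g f = (\<lambda>x\<in>T. x)" "compose T' f g = (\<lambda>x\<in>T'. x)"
    using coloured_isomorphism[OF T T' eq] .
  let ?F = "mor P ?J' ?J g" and ?G = "mor P ?J ?J' f"
  interpret F: linear_map K "obj P ?J" "obj P ?J'" ?F by (rule linear_mor[OF J(2,1) fg(2)])
  interpret G: linear_map K "obj P ?J'" "obj P ?J" ?G by (rule linear_mor[OF J fg(1)])
  have GF: "?G (?F v) = v" if "v \<in> carrier (obj P ?J)" for v
    using mor_comp[OF J(1,2,1) fg(1,2) that] mor_id[OF J(1) that] fg(3) by simp
  have FG: "?F (?G v) = v" if "v \<in> carrier (obj P ?J')" for v
    using mor_comp[OF J(2,1,2) fg(2,1) that] mor_id[OF J(2) that] fg(4) by simp
  show ?thesis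
  proof (rule F.dim_eq)
    show "vectorspace.fin_dim K (obj P ?J)" by (rule fin_dim_obj[OF J(1)])
    show "inj_on ?F (carrier (obj P ?J))" by (rule inj_on_inverseI) (rule GF)
    show "?F ` carrier (obj P ?J) = carrier (obj P ?J')"
    proof (intro subset_antisym subsetI)
      fix v assume v: "v \<in> carrier (obj P ?J')"
      then show "v \<in> ?F ` carrier (obj P ?J)" using FG[OF v] G.f_im by (metis imageI)
    qed (use F.f_im in auto)
  qed
qed

lemma (in pointed_collection) value_dim_coloured:
  assumes T: "finite T"
  shows "value_dim K P (fst (colour_count c T)) (part_sizes (colour_count c T)) =
    vectorspace.dim K (obj P (coloured c T))"
proof -
  obtain c' T' where "finite T'" "colour_count c' T' = colour_count c T"
    "value_dim K P (fst (colour_count c T)) (part_sizes (colour_count c T)) =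
      vectorspace.dim K (obj P (coloured c' T'))"
    by (rule value_dim_some)
  then show ?thesis using dim_coloured_cong[OF T, of T' c c'] by simp
qed

lemma contraction_product_dim:
  assumes P: "pointed_collection K P" and Q: "pointed_collection K Q" and J: "pointed_partition J"
  shows "vectorspace.dim K (obj (contraction_product K P Q) J) =
    (\<Sum>I | partition_on (ground J) I. vectorspace.dim K (obj P (contracted J I)) *
       (\<Prod>s\<in>I. vectorspace.dim K (obj Q (induced J s))))"
proof -
  interpret P: pointed_collection K P by fact
  interpret Q: pointed_collection K Q by fact
  have K: "field K" by (rule P.field_axioms)
  have fin: "finite (ground J)" using J by (simp add: pointed_partition_def)
  let ?W = "\<lambda>s. obj Q (induced J s)"
  have W: "vectorspace K (?W s)" "vectorspace.fin_dim K (?W s)" for s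
    using Q.vectorspace_obj Q.fin_dim_obj pointed_partition_induced[OF J] by auto
  have V: "vectorspace K (obj P (contracted J I))" "vectorspace.fin_dim K (obj P (contracted J I))"
    if "partition_on (ground J) I" for I
    using P.vectorspace_obj P.fin_dim_obj pointed_partition_contracted[OF J that] by auto
  have S: "vectorspace K (contraction_summand K P Q J I)" "vectorspace.fin_dim K (contraction_summand K P Q J I)"
    "vectorspace.dim K (contraction_summand K P Q J I) =
      vectorspace.dim K (obj P (contracted J I)) * (\<Prod>s\<in>I. vectorspace.dim K (?W s))"
    if I: "partition_on (ground J) I" for I
  proof -
    have finI: "finite I" by (rule finite_elements[OF fin I])
    note tv = tensor_family_vectorspace[OF K W(1), of I "\<lambda>s. s"]
    note td = tensor_family_dim[OF K finI W]
    show "vectorspace K (contraction_summand K P Q J I)"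
      unfolding contraction_summand_def by (rule tensor_vectorspace[OF V(1)[OF I] tv])
    show "vectorspace.fin_dim K (contraction_summand K P Q J I)"
      unfolding contraction_summand_def by (rule tensor_dim(1)[OF V(1)[OF I] tv V(2)[OF I] td(1)])
    show "vectorspace.dim K (contraction_summand K P Q J I) =
      vectorspace.dim K (obj P (contracted J I)) * (\<Prod>s\<in>I. vectorspace.dim K (?W s))"
      unfolding contraction_summand_def
      by (simp add: tensor_dim(2)[OF V(1)[OF I] tv V(2)[OF I] td(1)] td(2))
  qed
  have "vectorspace.dim K (obj (contraction_product K P Q) J) =
      (\<Sum>I | partition_on (ground J) I. vectorspace.dim K (contraction_summand K P Q J I))"
    unfolding contraction_product_def collection.simps
    by (rule finite_direct_sum_dim[OF K finitely_many_partition_on[OF fin]]) (use S in auto)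
  also have "\<dots> = (\<Sum>I | partition_on (ground J) I. vectorspace.dim K (obj P (contracted J I)) *
       (\<Prod>s\<in>I. vectorspace.dim K (?W s)))"
    by (rule sum.cong) (use S(3) in auto)
  finally show ?thesis .
qed

section \<open>Coefficients of the Young series\<close>

lemma part_sizes_simps:
  shows "0 \<notin># part_sizes e" "fst e + sum_mset (part_sizes e) = exponent_degree e"
    "fact (fst e) * (\<Prod>l\<in>#part_sizes e. fact l) = exponent_fact e"
    "monomial_symmetric \<mu> (snd e) = of_bool (part_sizes e = \<mu>)"
proof -
  show "0 \<notin># part_sizes e" using lookup_not_eq_zero_eq_in_keys by (fastforce simp: part_sizes_def)
  show "fst e + sum_mset (part_sizes e) = exponent_degree e"
    by (simp add: part_sizes_def exponent_degree_def sum_unfold_sum_mset)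
  show "fact (fst e) * (\<Prod>l\<in>#part_sizes e. fact l) = exponent_fact e"
    by (simp add: part_sizes_def exponent_fact_def prod_unfold_prod_mset multiset.map_comp comp_def)
  show "monomial_symmetric \<mu> (snd e) = of_bool (part_sizes e = \<mu>)"
    by (simp add: part_sizes_def monomial_symmetric_def)
qed

lemma exponent_degree_colour_count: "finite T \<Longrightarrow> exponent_degree (colour_count c T) = card T"
  by (induction T rule: finite_induct) (simp_all add: colour_count_insert exponent_degree_add_unit)

text \<open>A monomial in x occurs in exactly one monomial symmetric function, so at most one term
  of the sum over all types is nonzero.\<close>

lemma young_series_eq:
  "young_series K P e = of_bool (e = (1, 0)) +
     (if exponent_degree e \<ge> 2 then of_nat (value_dim K P (fst e) (part_sizes e)) / exponent_fact e else 0)"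
proof (cases e)
  case (Pair k \<alpha>)
  let ?t = "\<lambda>(n, \<mu>). if 0 \<notin># \<mu> \<and> n + sum_mset \<mu> \<ge> 2
       then of_nat (value_dim K P n \<mu>) * (of_bool (k = n) / fact n) *
            (monomial_symmetric \<mu> \<alpha> / (\<Prod>l\<in>#\<mu>. fact l)) else (0::rat)"
  have "Sum_any ?t = sum ?t {(k, part_sizes e)}"
    by (rule Sum_any.expand_superset)
       (use part_sizes_simps(4)[where e = e] in \<open>auto simp: Pair split: if_splits\<close>)
  also have "\<dots> = (if exponent_degree e \<ge> 2
      then of_nat (value_dim K P (fst e) (part_sizes e)) / exponent_fact e else 0)"
    using part_sizes_simps(1-3)[of e] part_sizes_simps(4)[where e = e] by (simp add: Pair)
  finally show ?thesis by (simp add: young_series_def Pair)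
qed

lemma colour_count_eq_marked_point_iff:
  assumes "finite S"
  shows "colour_count c S = (1, 0) \<longleftrightarrow> (\<exists>x. S = {x} \<and> c x = None)"
proof
  assume eq: "colour_count c S = (1, 0)"
  have "card S = 1"
    using exponent_degree_colour_count[OF assms, of c] by (simp add: eq exponent_degree_def)
  then obtain x where "S = {x}" by (rule card_1_singletonE)
  moreover from this have "c x = None"
    using eq by (cases "c x") (auto simp: colour_count_def)
  ultimately show "\<exists>x. S = {x} \<and> c x = None" by blast
qed (auto simp: colour_count_def)

text \<open>The factorials in the weight cancel those of the series, which leaves the bare
  dimension.\<close>

lemma set_weight_young_series:
  assumes "finite S"
  shows "set_weight c (young_series K P) S =
    (if card S \<ge> 2 then of_nat (value_dim K P (fst (colour_count c S)) (part_sizes (colour_count c S)))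
     else of_bool (\<exists>x. S = {x} \<and> c x = None))"
proof -
  let ?e = "colour_count c S"
  have deg: "exponent_degree ?e = card S" by (rule exponent_degree_colour_count[OF assms])
  have marked: "?e = (1, 0) \<longleftrightarrow> (\<exists>x. S = {x} \<and> c x = None)"
    by (rule colour_count_eq_marked_point_iff[OF assms])
  show ?thesis
  proof (cases "card S \<ge> 2")
    case True
    then have "?e \<noteq> (1, 0)" using deg by (auto simp: exponent_degree_def)
    with True show ?thesis by (simp add: set_weight_def young_series_eq deg)
  next
    case False
    then have "set_weight c (young_series K P) S = of_bool (?e = (1, 0)) * exponent_fact ?e"
      by (simp add: set_weight_def young_series_eq deg)
    also have "\<dots> = of_bool (?e = (1, 0))" by (auto simp: exponent_fact_def)
    finally show ?thesis using False marked by simp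
  qed
qed

context connected_collection
begin

text \<open>An unmarked point is excluded because its dimension is 1 but its weight 0. For a marked
  point, connectedness and the linear term z both give 1.\<close>

lemma set_weight_young_series_coloured:
  assumes S: "finite S" "S \<noteq> {}" and no: "\<not> (\<exists>x. S = {x} \<and> c x \<noteq> None)"
  shows "set_weight c (young_series K P) S = of_nat (vectorspace.dim K (obj P (coloured c S)))"
proof (cases "card S \<ge> 2")
  case True
  then show ?thesis using S(1) by (simp add: set_weight_young_series value_dim_coloured)
next
  case False
  moreover have "card S > 0" using S by (simp add: card_gt_0_iff)
  ultimately have card: "card S = 1" by simp
  then have "\<exists>x. S = {x} \<and> c x = None" using no by (auto simp: card_1_singleton_iff)
  then have "set_weight c (young_series K P) S = 1" using S(1) False by (simp add: set_weight_young_series)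
  moreover have "vectorspace.dim K (obj P (coloured c S)) = 1"
    by (rule dim_singleton) (use card S(1) pointed_partition_coloured in auto)
  ultimately show ?thesis by simp
qed

lemma dim_coloured_point: "vectorspace.dim K (obj P (coloured c {x})) = 1"
  by (rule dim_singleton) (auto intro: pointed_partition_coloured)

end

section \<open>Comparison of the two series\<close>

lemma young_series_zero: "young_series K P 0 = 0"
proof -
  have "(0 :: exponent) \<noteq> (1, 0)" by (simp add: zero_prod_def)
  then show ?thesis by (simp add: young_series_eq)
qed

text \<open>Unmarked singleton blocks contribute dimension 1 on the left and are left out of the
  product on the right. For the other blocks and for the contraction, dimension and weight
  coincide.\<close>

lemma contraction_summand_weight:
  fixes c :: "nat \<Rightarrow> nat option" and T :: "nat set"
  defines "V \<equiv> {x \<in> T. c x \<noteq> None}"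
  defines "e \<equiv> \<lambda>I. (card (I - (\<lambda>x. {x}) ` V), snd (colour_count c {x \<in> V. {x} \<in> I}))"
  assumes P: "connected_collection K P" and Q: "connected_collection K Q"
    and T: "finite T" "card T \<ge> 2" and I: "partition_on T I"
  shows "of_nat (vectorspace.dim K (obj P (contracted (coloured c T) I)) *
       (\<Prod>s\<in>I. vectorspace.dim K (obj Q (induced (coloured c T) s)))) =
    young_series K P (e I) * exponent_fact (e I) *
       (\<Prod>s\<in>I - (\<lambda>x. {x}) ` V. set_weight c (young_series K Q) s)"
proof -
  interpret P: connected_collection K P by fact
  interpret Q: connected_collection K Q by fact
  note blocks = partition_on_blocks[OF T(1) I]
  have finI: "finite I" by (rule finite_elements[OF T(1) I])
  let ?c = "contracted_colour c" and ?S = "set_encode ` I"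
  \<comment> \<open>If the contraction were a single unmarked point, \<open>T\<close> would be its
    own only block and a singleton, although it has at least two points.\<close>
  have "\<not> (\<exists>n. ?S = {n} \<and> ?c n \<noteq> None)"
  proof
    assume "\<exists>n. ?S = {n} \<and> ?c n \<noteq> None"
    then obtain n where n: "?S = {n}" "?c n \<noteq> None" by blast
    then obtain s where s: "s \<in> I" "n = set_encode s" by blast
    have "t = s" if "t \<in> I" for t
    proof (rule inj_onD[OF inj_on_set_encode])
      show "set_encode t = set_encode s" using n(1) s that by blast
    qed (use blocks(1) s(1) that in auto)
    then have "I = {s}" using s(1) by blast
    then have "T = s" using partition_onD1[OF I] by simp
    moreover obtain x where "s = {x}" using n(2) contracted_colour_encode(1)[OF blocks(1)[OF s(1)]] s(2) by auto
    ultimately show False using T(2) by simp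
  qed
  moreover have "I \<noteq> {}" using I T(2) by (auto simp: partition_on_def)
  ultimately have "of_nat (vectorspace.dim K (obj P (coloured ?c ?S))) = set_weight ?c (young_series K P) ?S"
    using finI by (intro P.set_weight_young_series_coloured[symmetric]) auto
  also have "\<dots> = young_series K P (e I) * exponent_fact (e I)"
    using colour_count_contracted[OF T(1) I, of c] by (simp add: set_weight_def e_def V_def)
  finally have left: "of_nat (vectorspace.dim K (obj P (contracted (coloured c T) I))) =
      young_series K P (e I) * exponent_fact (e I)"
    by (simp add: contracted_coloured[OF T(1) I])
  have Qs: "obj Q (induced (coloured c T) s) = obj Q (coloured c s)" if "s \<in> I" for s
    using blocks(3)[OF that] by (simp add: induced_coloured Int_absorb1)
  have "(\<Prod>s\<in>I. vectorspace.dim K (obj Q (induced (coloured c T) s))) =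
      (\<Prod>s\<in>I. vectorspace.dim K (obj Q (coloured c s)))"
    by (rule prod.cong) (simp_all add: Qs)
  also have "\<dots> = (\<Prod>s\<in>I - (\<lambda>x. {x}) ` V. vectorspace.dim K (obj Q (coloured c s)))"
    by (rule prod.mono_neutral_right[OF finI]) (auto simp: Q.dim_coloured_point)
  finally have "rat_of_nat (\<Prod>s\<in>I. vectorspace.dim K (obj Q (induced (coloured c T) s))) =
      (\<Prod>s\<in>I - (\<lambda>x. {x}) ` V. of_nat (vectorspace.dim K (obj Q (coloured c s))))"
    by (simp add: of_nat_prod)
  also have "\<dots> = (\<Prod>s\<in>I - (\<lambda>x. {x}) ` V. set_weight c (young_series K Q) s)"
  proof (rule prod.cong[OF refl])
    fix s assume s: "s \<in> I - (\<lambda>x. {x}) ` V"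
    then have "\<not> (\<exists>x. s = {x} \<and> c x \<noteq> None)" using blocks(3)[of s] by (auto simp: V_def)
    then show "of_nat (vectorspace.dim K (obj Q (coloured c s))) = set_weight c (young_series K Q) s"
      using s blocks(1,2)[of s] by (intro Q.set_weight_young_series_coloured[symmetric]) auto
  qed
  finally show ?thesis using left by simp
qed

lemma partition_on_point_iff: "partition_on {x} I \<longleftrightarrow> I = {{x}}"
proof
  assume I: "partition_on {x} I"
  have "s = {x}" if "s \<in> I" for s
    using partition_on_blocks[OF _ I that] by (auto simp: subset_singleton_iff)
  moreover have "I \<noteq> {}" using I by (auto simp: partition_on_def)
  ultimately show "I = {{x}}" by blast
qed (simp add: partition_on_space)

theorem theorem2p2p13:
  fixes K :: "'k ring"
    and P :: "('k, 'v) collection"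
    and Q :: "('k, 'w) collection"
  assumes "connected_collection K P"
    and "connected_collection K Q"
  shows "young_series K (contraction_product K P Q) =
         z_compose (young_series K P) (young_series K Q)"
proof
  fix e :: exponent
  interpret P: connected_collection K P by fact
  interpret Q: connected_collection K Q by fact
  let ?R = "contraction_product K P Q"
  let ?F = "young_series K P" and ?G = "young_series K Q"
  \<comment> \<open>The weights at one set with this colour count decide the coefficient at
    \<open>e\<close>, because the factorials are nonzero.\<close>
  obtain c T where T: "finite T" "colour_count c T = e"
    and dim: "value_dim K ?R (fst e) (part_sizes e) = vectorspace.dim K (obj ?R (coloured c T))"
    by (rule value_dim_some)
  let ?V = "{x \<in> T. c x \<noteq> None}"
  let ?s = "(\<lambda>x. {x}) ` ?V"
  let ?e = "\<lambda>I. (card (I - ?s), snd (colour_count c {x \<in> ?V. {x} \<in> I}))"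
  have point: "set_weight c ?G {x} = 0" if "x \<in> ?V" for x
    using that by (simp add: set_weight_young_series)
  have rhs: "set_weight c (z_compose ?F ?G) T = (\<Sum>I | partition_on T I.
      ?F (?e I) * exponent_fact (?e I) * (\<Prod>s\<in>I - ?s. set_weight c ?G s))"
    by (rule set_weight_z_compose_partitions) (simp_all only: T(1) young_series_zero point)
  have "set_weight c (young_series K ?R) T = set_weight c (z_compose ?F ?G) T"
  proof (cases "card T \<ge> 2")
    case True
    have "set_weight c (young_series K ?R) T = of_nat (vectorspace.dim K (obj ?R (coloured c T)))"
      using True T dim by (simp add: set_weight_young_series)
    also have "\<dots> = (\<Sum>I | partition_on T I. of_nat (vectorspace.dim K (obj P (contracted (coloured c T) I)) *
       (\<Prod>s\<in>I. vectorspace.dim K (obj Q (induced (coloured c T) s)))))"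
      by (simp only: contraction_product_dim[OF P.pointed_collection_axioms Q.pointed_collection_axioms
          pointed_partition_coloured[OF T(1)]] ground_coloured of_nat_sum)
    also have "\<dots> = (\<Sum>I | partition_on T I. ?F (?e I) * exponent_fact (?e I) *
       (\<Prod>s\<in>I - ?s. set_weight c ?G s))"
      by (rule sum.cong[OF refl]) (use contraction_summand_weight[OF assms T(1) True] in blast)
    also have "\<dots> = set_weight c (z_compose ?F ?G) T" by (rule rhs[symmetric])
    finally show ?thesis .
  next
    case False
    \<comment> \<open>Below two points the series of the product is prescribed to be z, so the
      composition is evaluated directly.\<close>
    then consider "T = {}" | x where "T = {x}"
      using T(1) by (metis Suc_1 card_0_eq card_1_singletonE less_Suc_eq less_one linorder_not_le)
    then show ?thesis
    proof cases
      case 1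
      \<comment> \<open>The only partition of the empty set has no blocks and contributes the
        constant term of the outer series.\<close>
      then have "set_weight c (z_compose ?F ?G) T = 0"
        unfolding rhs using young_series_zero[of K P] by (simp add: partition_on_empty zero_prod_def)
      then show ?thesis using 1 by (simp add: set_weight_young_series)
    next
      case (2 x)
      then have pt: "{I. partition_on T I} = {{{x}}}" by (auto simp: partition_on_point_iff)
      show ?thesis
      proof (cases "c x")
        case None
        \<comment> \<open>The single block is marked, so the two coefficients of z are
          multiplied.\<close>
        then have V: "?V = {}" using 2 by auto
        have "set_weight c (z_compose ?F ?G) T = ?F (1, 0) * exponent_fact (1, 0) * set_weight c ?G {x}"
          unfolding rhs pt V by simp
        also have "\<dots> = 1"
          using None by (simp add: young_series_eq exponent_degree_def exponent_fact_def set_weight_young_series)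
        finally show ?thesis using 2 None by (simp add: set_weight_young_series)
      next
        case (Some i)
        \<comment> \<open>The point is now taken by a variable x of the outer series, which has no
          term linear in x.\<close>
        then have V: "?V = {x}" using 2 by auto
        have "set_weight c (z_compose ?F ?G) T = 0"
          unfolding rhs pt V using Some
          by (simp add: young_series_eq exponent_degree_def colour_count_def)
        then show ?thesis using 2 Some by (simp add: set_weight_young_series)
      qed
    qed
  qed
  then show "young_series K ?R e = z_compose ?F ?G e" by (simp add: set_weight_def T(2))
qed

end
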